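(* Let $\mathbf{x}_1,\dots,\mathbf{x}_n$ be independent uniformly random points of $[0,1]^2$, and consider the complete graph on these points in which the cost of the edge $\{\mathbf{x}_i,\mathbf{x}_j\}$ is the Euclidean distance $|\mathbf{x}_i-\mathbf{x}_j|$. Color each edge independently and uniformly at random with one of $n-1$ colors. Let $Z_{\mathrm{MST}}$ be the minimum total length of a rainbow spanning tree (a spanning tree whose $n-1$ edges have pairwise distinct colors), and let $Z^*_{\mathrm{MST}}$ be the minimum total length of a spanning tree (with no color constraint). Then with high probability (probability tending to $1$ as $n\to\infty$) a rainbow spanning tree exists, $Z_{\mathrm{MST}}=\Theta(\sqrt n)$, and $Z_{\mathrm{MST}}-Z^*_{\mathrm{MST}}=\Theta(\sqrt n)$.
   Context: A set of edges is rainbow if all its colors are distinct. "With high probability" (w.h.p.) means with probability tending to $1$ as $n\to\infty$. The point positions and the colors are independent. *)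

theory Defs
  imports "HOL-Probability.Probability"
begin

type_synonym point = "real \<times> real"
type_synonym edge = "nat set"

definition complete_edges :: "nat \<Rightarrow> edge set" where
  "complete_edges n = {e. e \<subseteq> {1..n} \<and> card e = 2}"

definition graph_connected :: "nat set \<Rightarrow> edge set \<Rightarrow> bool" where
  "graph_connected V T \<longleftrightarrow> (\<forall>u\<in>V. \<forall>v\<in>V. (u, v) \<in> {(a, b). {a, b} \<in> T}\<^sup>*)"

text \<open>A cycle is given by its list of distinct vertices, in cyclic order.\<close>

definition is_cycle :: "edge set \<Rightarrow> nat list \<Rightarrow> bool" where
  "is_cycle T vs \<longleftrightarrow> 3 \<le> length vs \<and> distinct vs \<and>
     (\<forall>i<length vs. {vs ! i, vs ! (Suc i mod length vs)} \<in> T)"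

definition spanning_tree :: "nat \<Rightarrow> edge set \<Rightarrow> bool" where
  "spanning_tree n T \<longleftrightarrow>
     T \<subseteq> complete_edges n \<and> graph_connected {1..n} T \<and> (\<nexists>vs. is_cycle T vs)"

definition rainbow :: "(edge \<Rightarrow> nat) \<Rightarrow> edge set \<Rightarrow> bool" where
  "rainbow col T \<longleftrightarrow> inj_on col T"

text \<open>
  On an edge \<open>{i, j}\<close>, \<open>Min\<close> and \<open>Max\<close> merely pick out the two endpoints. The
  distance on \<open>real \<times> real\<close> is the Euclidean one.
\<close>

definition edge_length :: "(nat \<Rightarrow> point) \<Rightarrow> edge \<Rightarrow> real" where
  "edge_length x e = dist (x (Min e)) (x (Max e))"

definition total_length :: "(nat \<Rightarrow> point) \<Rightarrow> edge set \<Rightarrow> real" where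
  "total_length x T = (\<Sum>e\<in>T. edge_length x e)"

definition Z_MST_opt :: "nat \<Rightarrow> (nat \<Rightarrow> point) \<Rightarrow> real" where
  "Z_MST_opt n x = Min (total_length x ` {T. spanning_tree n T})"

text \<open>The following value is meaningful only if a rainbow spanning tree exists.\<close>

definition Z_MST :: "nat \<Rightarrow> (nat \<Rightarrow> point) \<Rightarrow> (edge \<Rightarrow> nat) \<Rightarrow> real" where
  "Z_MST n x col = Min (total_length x ` {T. spanning_tree n T \<and> rainbow col T})"

text \<open>
  Product measures make all positions and colors jointly independent. For \<open>n \<le> 1\<close> there
  are neither edges nor colors.
\<close>

definition random_instance :: "nat \<Rightarrow> ((nat \<Rightarrow> point) \<times> (edge \<Rightarrow> nat)) measure" where
  "random_instance n =
     (\<Pi>\<^sub>M i\<in>{1..n}. uniform_measure lborel ({0..1} \<times> {0..1}))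
       \<Otimes>\<^sub>M (\<Pi>\<^sub>M e\<in>complete_edges n. uniform_count_measure {1..n - 1})"

definition whp :: "(nat \<Rightarrow> 'a measure) \<Rightarrow> (nat \<Rightarrow> 'a \<Rightarrow> bool) \<Rightarrow> bool" where
  "whp M P \<longleftrightarrow> (\<lambda>n. \<P>(\<omega> in M n. P n \<omega>)) \<longlonglongrightarrow> 1"

end

theory Submission
  imports Defs
begin

text \<open>
  The upper bound holds for every position of the points. Let \<open>N = n - 1\<close>. A spanning tree
  arises when every vertex but the first chooses a parent of smaller index, so a rainbow spanning
  tree arises from a system of distinct representatives of the color sets of the candidate edges,
  each vertex proposing edges to some smaller vertices nearby. The vertex of rank \<open>\<rho>\<close>, in a
  suitable ranking, proposes about \<open>N / \<rho>\<close> edges. A pigeonhole argument on grids ranks the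
  vertices such that these have length \<open>O(sqrt (N / (\<rho> * (N + 1 - \<rho>))))\<close>, which sums to
  \<open>O(sqrt N)\<close>, and a union bound shows that Hall's condition fails with probability \<open>O(1 / N)\<close>.

  For the gap, linearly many pairs of points are alone in a grid cell of side \<open>\<Theta>(1 / sqrt n)\<close> and
  close to its centre (second moment method). Linearly many of the edges joining them repeat a
  color, so a rainbow tree omits linearly many of them, and exchanging each omitted one for
  another edge at the same vertex saves \<open>\<Omega>(1 / sqrt n)\<close>.
\<close>

section \<open>Spanning trees and edge exchange\<close>

text \<open>There are exactly as many colors as tree edges, so a rainbow spanning tree uses every
  color and the candidate edges must already show all of them. As in the coupon collector problem
  this takes about \<open>N * ln N\<close> edges; boundedly many short edges per vertex would
  typically miss linearly many colors. This forces the uneven numbers of proposals. Rank and index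
  have separate roles. The rank decides how many candidates a vertex gets, the index which ones are
  allowed: proposing only smaller indices excludes cycles whatever is chosen, and makes the
  candidate sets of different vertices disjoint, hence their colors independent. The geometry then
  enters the union bound only through the sizes of these sets. Two estimates give all four
  inequalities. Because \<open>Z_MST_opt\<close> is nonnegative, the lower bound on the gap is also
  one on \<open>Z_MST\<close>, and the upper bound on \<open>Z_MST\<close> is also one on the gap.
  The constants are chosen for easy verification, not for sharpness.\<close>

definition adj :: "edge set \<Rightarrow> (nat \<times> nat) set" where
  "adj S = {(a, b). {a, b} \<in> S}"

lemma adj_iff [simp]: "(a, b) \<in> adj S \<longleftrightarrow> {a, b} \<in> S"
  by (simp add: adj_def)

lemma sym_adj: "sym (adj S)"
  by (auto simp: sym_def insert_commute)

lemma rtrancl_adj_sym: "(a, b) \<in> (adj S)\<^sup>* \<Longrightarrow> (b, a) \<in> (adj S)\<^sup>*"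
  using sym_adj sym_rtrancl symD by metis

lemma graph_connected_adj:
  "graph_connected V S \<longleftrightarrow> (\<forall>u\<in>V. \<forall>v\<in>V. (u, v) \<in> (adj S)\<^sup>*)"
  by (simp add: graph_connected_def adj_def)

text \<open>Every edge of \<open>S\<close> may be replaced by a path in \<open>S'\<close>. Each use
  below takes away a single edge, so only that edge needs a real detour.\<close>

lemma graph_connected_subst:
  assumes "graph_connected V S"
    and "\<And>a b. {a, b} \<in> S \<Longrightarrow> (a, b) \<in> (adj S')\<^sup>*"
  shows "graph_connected V S'"
proof -
  have "adj S \<subseteq> (adj S')\<^sup>*"
    using assms(2) by auto
  then have "(adj S)\<^sup>* \<subseteq> (adj S')\<^sup>*"
    by (metis rtrancl_idemp rtrancl_mono)
  then show ?thesis
    using assms(1) unfolding graph_connected_adj by blast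
qed

lemma finite_complete_edges [simp]: "finite (complete_edges n)"
  unfolding complete_edges_def by (rule finite_subset[of _ "Pow {1..n}"]) auto

text \<open>The other edges of the cycle lead from \<open>vs ! 1\<close> round to
  \<open>vs ! 0\<close> and serve as a detour for the removed edge.\<close>

lemma connected_remove_cycle_edge:
  assumes conn: "graph_connected V S" and cyc: "is_cycle S vs"
  shows "graph_connected V (S - {{vs ! 0, vs ! 1}})"
proof -
  define L where "L = length vs"
  define S' where "S' = S - {{vs ! 0, vs ! 1}}"
  have L: "3 \<le> L" and dist: "distinct vs"
    and ed: "\<And>i. i < L \<Longrightarrow> {vs ! i, vs ! (Suc i mod L)} \<in> S"
    using cyc unfolding is_cycle_def L_def by auto
  have ne: "vs ! i = vs ! j \<longleftrightarrow> i = j" if "i < L" "j < L" for i j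
    using dist that unfolding L_def by (simp add: nth_eq_iff_index_eq)
  \<comment> \<open>As the cycle has at least 3 distinct vertices, no later edge, the closing one
    included, is the pair \<open>{vs ! 0, vs ! 1}\<close> again.\<close>
  have step: "{vs ! i, vs ! (Suc i mod L)} \<in> S'" if "1 \<le> i" "i < L" for i
  proof -
    have "Suc i mod L = (if Suc i = L then 0 else Suc i)"
      using that by auto
    moreover have "Suc i mod L < L" using L by auto
    ultimately have "{vs ! i, vs ! (Suc i mod L)} \<noteq> {vs ! 0, vs ! 1}"
      using that L ne[of i 0] ne[of i 1] ne[of "Suc i mod L" 0] ne[of "Suc i mod L" 1]
      by (auto simp: doubleton_eq_iff split: if_splits)
    then show ?thesis using ed[OF that(2)] by (simp add: S'_def)
  qed
  have path: "(vs ! 1, vs ! (Suc i)) \<in> (adj S')\<^sup>*" if "Suc i < L" for i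
    using that
  proof (induction i)
    case (Suc i)
    have "{vs ! Suc i, vs ! (Suc (Suc i) mod L)} \<in> S'"
      using Suc.prems by (intro step) auto
    then have "(vs ! Suc i, vs ! Suc (Suc i)) \<in> adj S'"
      using Suc.prems by simp
    then show ?case using Suc by (meson Suc_lessD rtrancl.rtrancl_into_rtrancl)
  qed simp
  have "(vs ! 1, vs ! (L - 1)) \<in> (adj S')\<^sup>*"
    using path[of "L - 2"] L by (simp add: numeral_2_eq_2 Suc_diff_Suc)
  moreover have "(vs ! (L - 1), vs ! 0) \<in> adj S'"
    using step[of "L - 1"] L by simp
  ultimately have 10: "(vs ! 1, vs ! 0) \<in> (adj S')\<^sup>*"
    by (rule rtrancl_into_rtrancl)
  show ?thesis unfolding S'_def[symmetric]
  proof (rule graph_connected_subst[OF conn])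
    fix a b assume "{a, b} \<in> S"
    show "(a, b) \<in> (adj S')\<^sup>*"
    proof (cases "{a, b} = {vs ! 0, vs ! 1}")
      case True
      then show ?thesis using 10 rtrancl_adj_sym[OF 10] by (auto simp: doubleton_eq_iff)
    next
      case False
      then have "(a, b) \<in> adj S'" using \<open>{a, b} \<in> S\<close> unfolding S'_def adj_iff by blast
      then show ?thesis by blast
    qed
  qed
qed

lemma connected_contains_spanning_tree:
  assumes "S \<subseteq> complete_edges n" "graph_connected {1..n} S"
  shows "\<exists>T\<subseteq>S. spanning_tree n T"
  using assms
proof (induction "card S" arbitrary: S rule: less_induct)
  case less
  show ?case
  proof (cases "\<exists>vs. is_cycle S vs")
    case True
    then obtain vs where vs: "is_cycle S vs" by blast
    let ?e = "{vs ! 0, vs ! 1}"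
    have "?e \<in> S" using vs unfolding is_cycle_def
      by (auto dest!: spec[of _ 0])
    moreover have "finite S" using less.prems finite_complete_edges finite_subset by blast
    ultimately have "card (S - {?e}) < card S" by (meson card_Diff1_less)
    from less.hyps[OF this] obtain T where "T \<subseteq> S - {?e}" "spanning_tree n T"
      using connected_remove_cycle_edge[OF less.prems(2) vs] less.prems by auto
    then show ?thesis by auto
  next
    case False
    then show ?thesis using less.prems unfolding spanning_tree_def by auto
  qed
qed

lemma finite_spanning_trees: "finite {T. spanning_tree n T \<and> P T}"
  by (rule finite_subset[of _ "Pow (complete_edges n)"]) (auto simp: spanning_tree_def)

lemma total_length_mono:
  assumes "finite S" "T \<subseteq> S"
  shows "total_length x T \<le> total_length x S"
  unfolding total_length_def by (rule sum_mono2) (use assms in \<open>auto simp: edge_length_def\<close>)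

text \<open>Lengths are nonnegative, so passing to a spanning tree inside \<open>S\<close> costs
  nothing. The exchange argument may therefore stop at any connected graph.\<close>

lemma Z_MST_opt_le:
  assumes "S \<subseteq> complete_edges n" "graph_connected {1..n} S"
  shows "Z_MST_opt n x \<le> total_length x S"
proof -
  obtain T where T: "T \<subseteq> S" "spanning_tree n T"
    using connected_contains_spanning_tree[OF assms] by blast
  have "Z_MST_opt n x \<le> total_length x T"
    unfolding Z_MST_opt_def using T finite_spanning_trees[of n "\<lambda>_. True"] by (intro Min_le) auto
  also have "\<dots> \<le> total_length x S"
    using T assms finite_complete_edges finite_subset by (intro total_length_mono) blast+
  finally show ?thesis .
qed

lemma Z_MST_attained:
  assumes "spanning_tree n T" "rainbow col T"
  obtains T' where "spanning_tree n T'" "rainbow col T'" "Z_MST n x col = total_length x T'"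
proof -
  have "Z_MST n x col \<in> total_length x ` {T. spanning_tree n T \<and> rainbow col T}"
    unfolding Z_MST_def using assms finite_spanning_trees[of n "rainbow col"]
    by (intro Min_in) auto
  then show ?thesis using that by blast
qed

lemma Z_MST_le:
  assumes "spanning_tree n T" "rainbow col T"
  shows "Z_MST n x col \<le> total_length x T"
  unfolding Z_MST_def using assms finite_spanning_trees[of n "rainbow col"]
  by (intro Min_le) auto

section \<open>Exchanging edges at isolated pairs\<close>

lemma edge_length_doubleton: "edge_length x {i, j} = dist (x i) (x j)"
proof -
  have "Min {i, j} = min i j" "Max {i, j} = max i j" by auto
  then show ?thesis
    by (cases "i \<le> j") (auto simp: edge_length_def min_def max_def dist_commute)
qed

text \<open>A walk from \<open>u\<close> to \<open>v\<close>, started at its last visit to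
  \<open>u\<close>, begins with an edge \<open>{u, w}\<close> and then avoids \<open>u\<close>. Its
  remainder together with \<open>{u, v}\<close> is a detour for \<open>{u, w}\<close>. The removed
  edge thus lies at \<open>u\<close>, where isolation bounds its length from below.\<close>

lemma first_edge_exchange:
  assumes conn: "graph_connected V S" and uv: "u \<in> V" "v \<in> V" "u \<noteq> v" "{u, v} \<notin> S"
  obtains w where "w \<noteq> v" "{u, w} \<in> S" "graph_connected V (insert {u, v} (S - {{u, w}}))"
proof -
  define R where "R = {(a, b). {a, b} \<in> S \<and> u \<notin> {a, b}}"
  \<comment> \<open>Induction along the walk: an edge leaving \<open>u\<close> restarts it with
    \<open>w = z\<close>, and for \<open>z = u\<close> nothing is claimed.\<close>
  have ex: "z \<noteq> u \<longrightarrow> (\<exists>w. {u, w} \<in> S \<and> (w, z) \<in> R\<^sup>*)" if "(u, z) \<in> (adj S)\<^sup>*" for z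
    using that
  proof (induction rule: rtrancl_induct)
    case (step y z)
    show ?case
    proof (cases "y = u \<or> z = u")
      case True
      then show ?thesis using step by auto
    next
      case False
      then obtain w where "{u, w} \<in> S" "(w, y) \<in> R\<^sup>*" using step by blast
      moreover have "(y, z) \<in> R" using False step by (auto simp: R_def)
      ultimately show ?thesis by (meson rtrancl.rtrancl_into_rtrancl)
    qed
  qed simp
  have "(u, v) \<in> (adj S)\<^sup>*" using conn uv by (simp add: graph_connected_adj)
  then obtain w where w: "{u, w} \<in> S" "(w, v) \<in> R\<^sup>*" using ex uv by blast
  define S' where "S' = insert {u, v} (S - {{u, w}})"
  have "R \<subseteq> adj S'" by (auto simp: R_def S'_def)
  then have "(w, v) \<in> (adj S')\<^sup>*" using w rtrancl_mono by blast
  moreover have "(v, u) \<in> adj S'" by (auto simp: S'_def insert_commute)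
  ultimately have wu: "(w, u) \<in> (adj S')\<^sup>*" by (rule rtrancl_into_rtrancl)
  have "graph_connected V S'"
  proof (rule graph_connected_subst[OF conn])
    fix a b assume "{a, b} \<in> S"
    show "(a, b) \<in> (adj S')\<^sup>*"
    proof (cases "{a, b} = {u, w}")
      case True
      then show ?thesis using wu rtrancl_adj_sym[OF wu] by (auto simp: doubleton_eq_iff)
    next
      case False
      then have "(a, b) \<in> adj S'" using \<open>{a, b} \<in> S\<close> unfolding S'_def adj_iff by blast
      then show ?thesis by blast
    qed
  qed
  moreover have "w \<noteq> v" using w uv by auto
  ultimately show ?thesis using that w unfolding S'_def by blast
qed

definition isolated_pair :: "nat \<Rightarrow> (nat \<Rightarrow> point) \<Rightarrow> real \<Rightarrow> real \<Rightarrow> edge \<Rightarrow> bool" where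
  "isolated_pair n x \<alpha> \<beta> e \<longleftrightarrow> e \<in> complete_edges n \<and> edge_length x e \<le> \<alpha> \<and>
     (\<forall>u\<in>e. \<forall>w\<in>{1..n} - e. \<beta> \<le> dist (x u) (x w))"

text \<open>Inserting the missing pair \<open>e\<close> costs at most \<alpha>, and the edge removed
  in return leaves the pair at one of its points, so it has length at least \<beta>. Only the
  isolation of \<open>e\<close> is used for this, so it does not matter whether the removed edge
  came from \<open>T\<close> or was inserted earlier.\<close>

lemma isolated_pairs_exchange:
  assumes T: "T \<subseteq> complete_edges n" "graph_connected {1..n} T"
    and F: "finite F" "\<And>e. e \<in> F \<Longrightarrow> isolated_pair n x \<alpha> \<beta> e" "F \<inter> T = {}"
  shows "\<exists>S \<subseteq> T \<union> F. graph_connected {1..n} S \<and>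
           total_length x S \<le> total_length x T - real (card F) * (\<beta> - \<alpha>)"
  using F
proof (induction F rule: finite_induct)
  case empty
  then show ?case using T by (intro exI[of _ T]) auto
next
  case (insert e F)
  then obtain S where S: "S \<subseteq> T \<union> F" "graph_connected {1..n} S"
     "total_length x S \<le> total_length x T - real (card F) * (\<beta> - \<alpha>)"
    by auto
  have iso: "isolated_pair n x \<alpha> \<beta> e" using insert by auto
  then obtain u v where e: "e = {u, v}" "u \<noteq> v" "u \<in> {1..n}" "v \<in> {1..n}"
    by (auto simp: isolated_pair_def complete_edges_def card_2_iff)
  have eS: "e \<notin> S" using insert S by auto
  obtain w where w: "w \<noteq> v" "{u, w} \<in> S"
    and conn: "graph_connected {1..n} (insert e (S - {{u, w}}))"
    using first_edge_exchange[OF S(2) e(3,4,2)] eS e(1) by metis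
  have sub: "T \<union> F \<subseteq> complete_edges n" using T insert by (auto simp: isolated_pair_def)
  then have finS: "finite S" using S finite_complete_edges by (meson finite_subset)
  have "{u, w} \<in> complete_edges n" using w S sub by auto
  then have "w \<in> {1..n}" "w \<noteq> u" by (auto simp: complete_edges_def card_2_iff doubleton_eq_iff)
  then have len: "\<beta> \<le> edge_length x {u, w}" "edge_length x e \<le> \<alpha>"
    using iso w e by (auto simp: isolated_pair_def edge_length_doubleton)
  have "total_length x (insert e (S - {{u, w}})) =
      edge_length x e + (total_length x S - edge_length x {u, w})"
    unfolding total_length_def using finS w eS by (simp add: sum_diff1)
  also have "\<dots> \<le> total_length x S - (\<beta> - \<alpha>)" using len by simp
  also have "\<dots> \<le> total_length x T - real (card (insert e F)) * (\<beta> - \<alpha>)"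
    using S(3) insert by (simp add: algebra_simps)
  finally show ?case using conn S(1) by (intro exI[of _ "insert e (S - {{u, w}})"]) auto
qed

lemma Z_MST_gap:
  assumes ex: "spanning_tree n T" "rainbow col T"
    and E: "finite E" "\<And>e. e \<in> E \<Longrightarrow> isolated_pair n x \<alpha> \<beta> e" and "\<alpha> \<le> \<beta>"
  shows "(real (card E) - card (col ` E)) * (\<beta> - \<alpha>) \<le> Z_MST n x col - Z_MST_opt n x"
proof -
  obtain T' where T': "spanning_tree n T'" "rainbow col T'" "Z_MST n x col = total_length x T'"
    using Z_MST_attained[OF ex] by blast
  have "\<exists>S \<subseteq> T' \<union> (E - T'). graph_connected {1..n} S \<and>
           total_length x S \<le> total_length x T' - real (card (E - T')) * (\<beta> - \<alpha>)"
    using T' E by (intro isolated_pairs_exchange) (auto simp: spanning_tree_def)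
  then obtain S where S: "S \<subseteq> T' \<union> E" "graph_connected {1..n} S"
    "total_length x S \<le> total_length x T' - real (card (E - T')) * (\<beta> - \<alpha>)" by auto
  have "Z_MST_opt n x \<le> total_length x S"
    using S T' E by (intro Z_MST_opt_le) (auto simp: spanning_tree_def isolated_pair_def)
  then have 1: "real (card (E - T')) * (\<beta> - \<alpha>) \<le> Z_MST n x col - Z_MST_opt n x"
    using S T' by simp
  have "card (E \<inter> T') = card (col ` (E \<inter> T'))"
    using T'(2) by (metis card_image inf_le2 inj_on_subset rainbow_def)
  also have "\<dots> \<le> card (col ` E)" using E by (intro card_mono) auto
  finally have "card E - card (col ` E) \<le> card (E - T')"
    using card_Diff_subset_Int[of E T'] E by (simp add: card_Diff_subset_Int)
  then have "real (card E) - card (col ` E) \<le> card (E - T')" by linarith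
  then have "(real (card E) - card (col ` E)) * (\<beta> - \<alpha>) \<le> real (card (E - T')) * (\<beta> - \<alpha>)"
    using \<open>\<alpha> \<le> \<beta>\<close> by (intro mult_right_mono) auto
  then show ?thesis using 1 by linarith
qed

lemma Z_MST_opt_nonneg:
  assumes "spanning_tree n T"
  shows "0 \<le> Z_MST_opt n x"
proof -
  have "Z_MST_opt n x \<in> total_length x ` {T. spanning_tree n T}"
    unfolding Z_MST_opt_def using assms finite_spanning_trees[of n "\<lambda>_. True"]
    by (intro Min_in) auto
  then show ?thesis by (auto simp: total_length_def edge_length_def intro!: sum_nonneg)
qed

text \<open>Following parents leads from every vertex down to 1, which gives connectivity. On a
  cycle the largest vertex would have two different smaller neighbors, but the only smaller neighbor
  of a vertex is its parent.\<close>

lemma parent_tree: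
  assumes p: "\<And>i. i \<in> {2..n} \<Longrightarrow> p i \<in> {1..<i}"
  shows "spanning_tree n ((\<lambda>i. {i, p i}) ` {2..n})"
proof -
  let ?T = "(\<lambda>i. {i, p i}) ` {2..n}"
  have sub: "?T \<subseteq> complete_edges n"
    using p by (force simp: complete_edges_def card_2_iff)
  have root: "(i, 1) \<in> (adj ?T)\<^sup>*" if "i \<in> {1..n}" for i
    using that
  proof (induction i rule: less_induct)
    case (less i)
    show ?case
    proof (cases "i = 1")
      case False
      then have i: "i \<in> {2..n}" using less by auto
      then have "(i, p i) \<in> adj ?T" by auto
      moreover have "(p i, 1) \<in> (adj ?T)\<^sup>*" using p[OF i] less by auto
      ultimately show ?thesis by (rule converse_rtrancl_into_rtrancl)
    qed simp
  qed
  have conn: "graph_connected {1..n} ?T"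
    unfolding graph_connected_adj using root rtrancl_adj_sym rtrancl_trans by metis
  have down: "b = p a" if "{a, b} \<in> ?T" "b < a" for a b
  proof -
    from that(1) obtain i where "i \<in> {2..n}" "{a, b} = {i, p i}" by (rule imageE)
    then show ?thesis using p[of i] that by (auto simp: doubleton_eq_iff)
  qed
  have "\<not> is_cycle ?T vs" for vs
  proof
    assume "is_cycle ?T vs"
    then have L: "3 \<le> length vs" "distinct vs"
      and ed: "\<And>i. i < length vs \<Longrightarrow> {vs ! i, vs ! (Suc i mod length vs)} \<in> ?T"
      by (auto simp: is_cycle_def)
    let ?L = "length vs"
    have "Max (set vs) \<in> set vs" using L by (intro Max_in) auto
    then obtain i where i: "i < ?L" "vs ! i = Max (set vs)" by (metis in_set_conv_nth)
    have lt: "vs ! j < vs ! i" if "j < ?L" "j \<noteq> i" for j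
    proof -
      have "vs ! j \<le> Max (set vs)" using that by (intro Max_ge) auto
      moreover have "vs ! j \<noteq> vs ! i" using nth_eq_iff_index_eq[OF L(2) that(1) i(1)] that(2) by simp
      ultimately show ?thesis using i by simp
    qed
    \<comment> \<open>\<open>k\<close> and \<open>h\<close> are the positions after and before the
      maximum; they differ because the cycle has length at least 3.\<close>
    define k where "k = Suc i mod ?L"
    define h where "h = (if i = 0 then ?L - 1 else i - 1)"
    have kk: "k = (if Suc i = ?L then 0 else Suc i)" using i by (simp add: k_def)
    then have k: "k < ?L" "k = (if Suc i = ?L then 0 else Suc i)" using i(1) by (auto split: if_splits)
    have h: "h < ?L" "Suc h mod ?L = i" using i(1) L(1) by (cases i; simp add: h_def)+
    have ne: "k \<noteq> i" "h \<noteq> i" "h \<noteq> k" using i(1) L(1) by (auto simp: kk h_def split: if_splits)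
    have "vs ! k = p (vs ! i)" using ed[OF i(1)] lt[OF k(1) ne(1)] by (intro down) (auto simp: k_def)
    moreover have "vs ! h = p (vs ! i)"
      using ed[OF h(1)] lt[OF h(1) ne(2)] h(2) by (intro down) (auto simp: insert_commute)
    ultimately show False using ne(3) nth_eq_iff_index_eq[OF L(2) k(1) h(1)] by simp
  qed
  then show ?thesis using sub conn by (auto simp: spanning_tree_def)
qed

section \<open>Hall's theorem and the ranking of the vertices\<close>

text \<open>Induction on the size of \<open>I\<close>. If some nonempty proper \<open>J\<close> is
  tight, it is matched within its own union, and the rest outside of it: Hall's condition for
  \<open>K \<union> J\<close> minus the tight \<open>J\<close> gives the one for \<open>K\<close>.
  If there is no tight set, \<open>i\<close> takes an arbitrary \<open>y\<close>, and the slack of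
  one in every other nonempty set pays for its removal.\<close>

lemma hall_marriage:
  fixes A :: "'a \<Rightarrow> 'b set"
  assumes "finite I" "\<And>i. i \<in> I \<Longrightarrow> finite (A i)"
    and "\<And>J. J \<subseteq> I \<Longrightarrow> card J \<le> card (\<Union> (A ` J))"
  shows "\<exists>f. (\<forall>i\<in>I. f i \<in> A i) \<and> inj_on f I"
  using assms
proof (induction "card I" arbitrary: I A rule: less_induct)
  case less
  show ?case
  proof (cases "I = {}")
    case False
    then obtain i where i: "i \<in> I" by auto
    show ?thesis
    proof (cases "\<exists>J. J \<subset> I \<and> J \<noteq> {} \<and> card (\<Union> (A ` J)) = card J")
      case True
      then obtain J where J: "J \<subset> I" "J \<noteq> {}" "card (\<Union> (A ` J)) = card J" by auto
      have finJ: "finite J" using J less.prems finite_subset by (metis psubset_imp_subset)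
      have "card J < card I" using J less.prems by (intro psubset_card_mono)
      then have "\<exists>f. (\<forall>i\<in>J. f i \<in> A i) \<and> inj_on f J"
        by (rule less.hyps) (use J finJ less.prems in auto)
      then obtain f where f: "\<forall>i\<in>J. f i \<in> A i" "inj_on f J" by auto
      let ?U = "\<Union> (A ` J)"
      let ?B = "\<lambda>i. A i - ?U"
      have "card (I - J) < card I" using J less.prems by (intro psubset_card_mono) auto
      then have "\<exists>g. (\<forall>i\<in>I-J. g i \<in> ?B i) \<and> inj_on g (I - J)"
      proof (rule less.hyps)
        fix K assume K: "K \<subseteq> I - J"
        then have finK: "finite K" using less.prems finite_subset by blast
        have "card K + card J = card (K \<union> J)"
          using K finJ finK by (subst card_Un_disjoint) auto
        also have "\<dots> \<le> card (\<Union> (A ` (K \<union> J)))"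
          using K J by (intro less.prems(3)) auto
        also have "\<Union> (A ` (K \<union> J)) = \<Union> (?B ` K) \<union> ?U" by auto
        also have "card \<dots> \<le> card (\<Union> (?B ` K)) + card ?U" by (rule card_Un_le)
        finally show "card K \<le> card (\<Union> (?B ` K))" using J by simp
      qed (use less.prems in auto)
      then obtain g where g: "\<forall>i\<in>I-J. g i \<in> ?B i" "inj_on g (I - J)" by auto
      let ?h = "\<lambda>i. if i \<in> J then f i else g i"
      have "inj_on ?h J" "inj_on ?h (I - J)"
        using f(2) g(2) by (simp_all add: inj_on_def)
      moreover have "?h a \<noteq> ?h b" if "a \<in> J" "b \<in> I - J" for a b
        using f(1) g(1) that by auto
      ultimately have "inj_on ?h (J \<union> (I - J))"
        unfolding inj_on_Un by blast
      moreover have "J \<union> (I - J) = I" using J by auto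
      ultimately have "inj_on (\<lambda>i. if i \<in> J then f i else g i) I" by simp
      then show ?thesis using f g by (intro exI[of _ "\<lambda>i. if i \<in> J then f i else g i"]) auto
    next
      case False
      have "card {i} \<le> card (\<Union> (A ` {i}))" using i by (intro less.prems(3)) auto
      then have "A i \<noteq> {}" by auto
      then obtain y where y: "y \<in> A i" by auto
      let ?B = "\<lambda>j. A j - {y}"
      have "card (I - {i}) < card I" using i less.prems by (meson card_Diff1_less)
      then have "\<exists>g. (\<forall>j\<in>I-{i}. g j \<in> ?B j) \<and> inj_on g (I - {i})"
      proof (rule less.hyps)
        fix K assume K: "K \<subseteq> I - {i}"
        show "card K \<le> card (\<Union> (?B ` K))"
        proof (cases "K = {}")
          case False
          have "K \<subset> I" using K i by auto
          then have "card (\<Union> (A ` K)) \<noteq> card K" "card K \<le> card (\<Union> (A ` K))"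
            using False \<open>\<nexists>J. _ J\<close> less.prems(3)[of K] by auto
          moreover have "card (\<Union> (?B ` K)) = card (\<Union> (A ` K) - {y})" by (rule arg_cong[of _ _ card]) auto
          moreover have "card (\<Union> (A ` K)) - 1 \<le> card (\<Union> (A ` K) - {y})"
            using diff_card_le_card_Diff[of "{y}" "\<Union> (A ` K)"] by simp
          ultimately show ?thesis by linarith
        qed simp
      qed (use less.prems in auto)
      then obtain g where g: "\<forall>j\<in>I-{i}. g j \<in> ?B j" "inj_on g (I - {i})" by auto
      have "inj_on (g(i := y)) I" using g by (auto simp: inj_on_def)
      then show ?thesis using g y by (intro exI[of _ "g(i := y)"]) auto
    qed
  qed auto
qed

section \<open>Near predecessors and the greedy ranking\<close>

text \<open>The first \<open>d\<close> members of each class of \<open>c\<close> are the only ones with fewer than \<open>d\<close> predecessors.\<close>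

lemma card_few_predecessors:
  fixes c :: "nat \<Rightarrow> 'c"
  assumes V: "finite V" and C: "finite C" "c ` V \<subseteq> C"
  shows "card {i\<in>V. card {j\<in>V. j < i \<and> c j = c i} < d} \<le> d * card C"
proof -
  define B where "B = {i\<in>V. card {j\<in>V. j < i \<and> c j = c i} < d}"
  have "card {i\<in>B. c i = y} \<le> d" for y
  proof -
    have "inj_on (\<lambda>i. card {j\<in>V. j < i \<and> c j = c i}) {i\<in>B. c i = y}"
    proof (rule linorder_inj_onI')
      fix a b assume ab: "a \<in> {i\<in>B. c i = y}" "b \<in> {i\<in>B. c i = y}" "a < b"
      have "{j\<in>V. j < a \<and> c j = c a} \<subset> {j\<in>V. j < b \<and> c j = c b}"
        using ab unfolding B_def by force
      then have "card {j\<in>V. j < a \<and> c j = c a} < card {j\<in>V. j < b \<and> c j = c b}"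
        using V by (intro psubset_card_mono) auto
      then show "card {j\<in>V. j < a \<and> c j = c a} \<noteq> card {j\<in>V. j < b \<and> c j = c b}" by simp
    qed
    moreover have "(\<lambda>i. card {j\<in>V. j < i \<and> c j = c i}) ` {i\<in>B. c i = y} \<subseteq> {..<d}"
      by (auto simp: B_def)
    ultimately have "card {i\<in>B. c i = y} \<le> card {..<d}" by (rule card_inj_on_le) simp
    then show ?thesis by simp
  qed
  moreover have "B = (\<Union>y\<in>C. {i\<in>B. c i = y})" using C by (auto simp: B_def)
  then have "card B \<le> (\<Sum>y\<in>C. card {i\<in>B. c i = y})"
    using card_UN_le[OF C(1), of "\<lambda>y. {i\<in>B. c i = y}"] by simp
  ultimately have "card B \<le> (\<Sum>y\<in>C. d)" by (meson order_trans sum_mono)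
  then show ?thesis by (simp add: B_def mult.commute)
qed

text \<open>The minimum puts \<open>t = 1\<close>, whose floor would be \<open>k\<close>, into the
  last of the \<open>k\<close> cells.\<close>

definition grid_index :: "nat \<Rightarrow> real \<Rightarrow> nat" where
  "grid_index k t = min (k - 1) (nat \<lfloor>real k * t\<rfloor>)"

lemma grid_index_dist:
  assumes k: "0 < k" and t: "t \<in> {0..1}" "s \<in> {0..1}" and eq: "grid_index k t = grid_index k s"
  shows "\<bar>t - s\<bar> \<le> 1 / real k"
proof -
  have loc: "real (grid_index k r) \<le> real k * r \<and> real k * r \<le> real (grid_index k r) + 1"
    if "r \<in> {0..1}" for r
  proof (cases "nat \<lfloor>real k * r\<rfloor> \<le> k - 1")
    case True
    have "0 \<le> real k * r" using that by simp
    then have "real (nat \<lfloor>real k * r\<rfloor>) = real_of_int \<lfloor>real k * r\<rfloor>" by simp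
    then show ?thesis using True unfolding grid_index_def
      by simp
  next
    case False
    then have "real (k - 1) < real (nat \<lfloor>real k * r\<rfloor>)" by simp
    moreover have "real (nat \<lfloor>real k * r\<rfloor>) \<le> real k * r" using that by simp
    moreover have "real k * r \<le> real k * 1" using that by (intro mult_left_mono) auto
    ultimately show ?thesis using False k unfolding grid_index_def
      by (simp add: min_def of_nat_diff)
  qed
  have "\<bar>real k * t - real k * s\<bar> \<le> 1" using loc[OF t(1)] loc[OF t(2)] eq by linarith
  then have "real k * \<bar>t - s\<bar> \<le> 1" by (simp add: abs_mult flip: right_diff_distrib)
  then show ?thesis using k by (simp add: field_simps)
qed

definition unit_square :: "point set" where
  "unit_square = {0..1} \<times> {0..1}"

lemma dist_same_grid_cell:
  assumes "0 < k" "p \<in> unit_square" "q \<in> unit_square"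
    "grid_index k (fst p) = grid_index k (fst q)" "grid_index k (snd p) = grid_index k (snd q)"
  shows "dist p q \<le> sqrt 2 / real k"
proof -
  have "\<bar>fst p - fst q\<bar> \<le> 1 / real k" "\<bar>snd p - snd q\<bar> \<le> 1 / real k"
    using assms by (auto intro!: grid_index_dist simp: unit_square_def)
  then have "(dist (fst p) (fst q))\<^sup>2 \<le> (1 / real k)\<^sup>2" "(dist (snd p) (snd q))\<^sup>2 \<le> (1 / real k)\<^sup>2"
    by (metis abs_ge_zero dist_real_def power_mono)+
  then have "dist p q \<le> sqrt (2 * (1 / real k)\<^sup>2)"
    unfolding dist_prod_def by (intro real_sqrt_le_mono) linarith
  also have "\<dots> = sqrt 2 / real k" by (simp add: real_sqrt_mult)
  finally show ?thesis .
qed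

text \<open>Points of one cell are within \<open>sqrt 2 / k\<close>, so a vertex with fewer than
  \<open>d\<close> near predecessors is among the first \<open>d\<close> of its cell. Vertex 1 is
  always among those, but the left side does not count it. This makes the inequality strict, which
  leaves the greedy choice a vertex to take.\<close>

lemma few_points_without_near_predecessors:
  fixes x :: "nat \<Rightarrow> point"
  assumes x: "\<And>i. i \<in> {1..n} \<Longrightarrow> x i \<in> unit_square" and d: "0 < d" and k: "0 < k" and n: "0 < n"
  shows "card {i\<in>{2..n}. card {j\<in>{1..<i}. dist (x i) (x j) \<le> sqrt 2 / real k} < d} < d * k\<^sup>2"
proof -
  define c :: "nat \<Rightarrow> nat \<times> nat" where "c i = (grid_index k (fst (x i)), grid_index k (snd (x i)))" for i
  let ?B = "{i\<in>{1..n}. card {j\<in>{1..n}. j < i \<and> c j = c i} < d}"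
  let ?A = "{i\<in>{2..n}. card {j\<in>{1..<i}. dist (x i) (x j) \<le> sqrt 2 / real k} < d}"
  have "card ?B \<le> d * card ({..<k} \<times> {..<k})"
    using k by (intro card_few_predecessors[of _ _ c]) (auto simp: c_def grid_index_def)
  then have B: "card ?B \<le> d * k\<^sup>2" by (simp add: card_cartesian_product power2_eq_square)
  have "?A \<subseteq> ?B"
  proof safe
    fix i assume i: "i \<in> {2..n}" "card {j\<in>{1..<i}. dist (x i) (x j) \<le> sqrt 2 / real k} < d"
    have "{j\<in>{1..n}. j < i \<and> c j = c i} \<subseteq> {j\<in>{1..<i}. dist (x i) (x j) \<le> sqrt 2 / real k}"
      using i x k by (auto intro!: dist_same_grid_cell simp: c_def)
    then have "card {j\<in>{1..n}. j < i \<and> c j = c i} \<le> card {j\<in>{1..<i}. dist (x i) (x j) \<le> sqrt 2 / real k}"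
      by (intro card_mono) auto
    then show "card {j\<in>{1..n}. j < i \<and> c j = c i} < d" using i by simp
  qed auto
  moreover have "1 \<in> ?B"
  proof -
    have "{j\<in>{1..n}. j < 1 \<and> c j = c 1} = {}" by auto
    then have "card {j\<in>{1..n}. j < 1 \<and> c j = c 1} < d" using d by (simp only: card.empty)
    then show ?thesis using n by auto
  qed
  ultimately have "?A \<subset> ?B" by force
  then have "card ?A < card ?B" by (intro psubset_card_mono) auto
  then show ?thesis using B by simp
qed

text \<open>
  The vertices are ranked greedily. When \<open>m = N + 1 - \<rho>\<close> of them are left, fewer than
  \<open>d \<rho> * k\<^sup>2 \<le> m\<close> lack \<open>d \<rho>\<close> predecessors in their own cell of the \<open>k\<close>-grid.
\<close>

lemma greedy_ranking:
  fixes N :: nat and d :: "nat \<Rightarrow> nat" and x :: "nat \<Rightarrow> point"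
  assumes x: "\<And>i. i \<in> {1..N + 1} \<Longrightarrow> x i \<in> unit_square"
    and d: "\<And>\<rho>. \<rho> \<in> {1..N} \<Longrightarrow> 0 < d \<rho> \<and> d \<rho> \<le> N + 1 - \<rho>"
  obtains v where "bij_betw v {1..N} {2..N + 1}"
    and "\<And>\<rho>. \<rho> \<in> {1..N} \<Longrightarrow>
      d \<rho> \<le> card {j\<in>{1..<v \<rho>}. dist (x (v \<rho>)) (x j) \<le> 2 * sqrt 2 * sqrt (d \<rho> / (N + 1 - \<rho>))}"
proof -
  define good where "good \<rho> i \<longleftrightarrow>
      d \<rho> \<le> card {j\<in>{1..<i}. dist (x i) (x j) \<le> 2 * sqrt 2 * sqrt (d \<rho> / (N + 1 - \<rho>))}" for \<rho> i
  have bad: "card {i\<in>{2..N + 1}. \<not> good \<rho> i} < N + 1 - \<rho>" if \<rho>: "\<rho> \<in> {1..N}" for \<rho>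
  proof -
    define m where "m = N + 1 - \<rho>"
    \<comment> \<open>The finest grid with \<open>d \<rho> * k\<^sup>2 \<le> m\<close>. Because
      \<open>d \<rho> \<le> m\<close>, the root is at least 1 and rounding down loses at most a
      factor 2; together with the cell diagonal this is the \<open>2 * sqrt 2\<close> in the
      radius.\<close>
    define k where "k = nat \<lfloor>sqrt (m / d \<rho>)\<rfloor>"
    have dm: "0 < d \<rho>" "d \<rho> \<le> m" using d[OF \<rho>] by (auto simp: m_def)
    then have ge1: "1 \<le> sqrt (m / d \<rho>)" by simp
    then have "1 \<le> \<lfloor>sqrt (m / d \<rho>)\<rfloor>" by simp
    then have k: "0 < k" "real k = \<lfloor>sqrt (m / d \<rho>)\<rfloor>" by (auto simp: k_def)
    have k_le: "real k \<le> sqrt (m / d \<rho>)" unfolding k by simp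
    have "sqrt (m / d \<rho>) < real k + 1" unfolding k by linarith
    then have "sqrt (m / d \<rho>) \<le> 2 * real k" using k by linarith
    then have "1 / real k \<le> 2 / sqrt (m / d \<rho>)" using k ge1 by (simp add: field_simps)
    also have "\<dots> = 2 * sqrt (d \<rho> / m)" by (simp add: real_sqrt_divide)
    finally have "sqrt 2 * (1 / real k) \<le> sqrt 2 * (2 * sqrt (d \<rho> / m))" by (intro mult_left_mono) auto
    then have r: "sqrt 2 / real k \<le> 2 * sqrt 2 * sqrt (d \<rho> / m)" by (simp add: mult_ac)
    have "(real k)\<^sup>2 \<le> (sqrt (m / d \<rho>))\<^sup>2" using k_le by (intro power_mono) auto
    then have "d \<rho> * (real k)\<^sup>2 \<le> m" using dm by (simp add: field_simps)
    then have dk: "d \<rho> * k\<^sup>2 \<le> m" by (metis of_nat_le_iff of_nat_mult of_nat_power)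
    have "{i\<in>{2..N + 1}. \<not> good \<rho> i} \<subseteq>
          {i\<in>{2..N + 1}. card {j\<in>{1..<i}. dist (x i) (x j) \<le> sqrt 2 / real k} < d \<rho>}"
    proof safe
      fix i assume "i \<in> {2..N + 1}" "\<not> good \<rho> i"
      moreover have "card {j\<in>{1..<i}. dist (x i) (x j) \<le> sqrt 2 / real k}
        \<le> card {j\<in>{1..<i}. dist (x i) (x j) \<le> 2 * sqrt 2 * sqrt (d \<rho> / m)}"
        using r by (intro card_mono) auto
      ultimately show "card {j\<in>{1..<i}. dist (x i) (x j) \<le> sqrt 2 / real k} < d \<rho>"
        by (simp add: good_def m_def)
    qed
    then have "card {i\<in>{2..N + 1}. \<not> good \<rho> i} \<le>
       card {i\<in>{2..N + 1}. card {j\<in>{1..<i}. dist (x i) (x j) \<le> sqrt 2 / real k} < d \<rho>}"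
      by (intro card_mono) auto
    also have "\<dots> < d \<rho> * k\<^sup>2" using x dm k by (intro few_points_without_near_predecessors) auto
    finally show ?thesis using dk by (simp add: m_def)
  qed
  have "\<exists>v. inj_on v {1..r} \<and> v ` {1..r} \<subseteq> {2..N + 1} \<and> (\<forall>\<rho>\<in>{1..r}. good \<rho> (v \<rho>))" if "r \<le> N" for r
    using that
  proof (induction r)
    case (Suc r)
    then obtain v where v: "inj_on v {1..r}" "v ` {1..r} \<subseteq> {2..N + 1}" "\<forall>\<rho>\<in>{1..r}. good \<rho> (v \<rho>)"
      by auto
    have "card (v ` {1..r} \<union> {i\<in>{2..N + 1}. \<not> good (Suc r) i}) < card {2..N + 1}"
    proof -
      have "card (v ` {1..r} \<union> {i\<in>{2..N + 1}. \<not> good (Suc r) i}) \<le>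
        card (v ` {1..r}) + card {i\<in>{2..N + 1}. \<not> good (Suc r) i}" by (rule card_Un_le)
      also have "card (v ` {1..r}) = r" using v by (simp add: card_image)
      also have "r + card {i\<in>{2..N + 1}. \<not> good (Suc r) i} < r + (N + 1 - Suc r)"
        using bad[of "Suc r"] Suc.prems by simp
      finally show ?thesis using Suc.prems by simp
    qed
    then have "\<not> {2..N + 1} \<subseteq> v ` {1..r} \<union> {i\<in>{2..N + 1}. \<not> good (Suc r) i}"
    proof (rule contrapos_pn)
      assume "{2..N + 1} \<subseteq> v ` {1..r} \<union> {i\<in>{2..N + 1}. \<not> good (Suc r) i}"
      then have "card {2..N + 1} \<le> card (v ` {1..r} \<union> {i\<in>{2..N + 1}. \<not> good (Suc r) i})"
        by (intro card_mono) auto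
      then show "\<not> card (v ` {1..r} \<union> {i\<in>{2..N + 1}. \<not> good (Suc r) i}) < card {2..N + 1}"
        by simp
    qed
    then obtain w where w: "w \<in> {2..N + 1}" "w \<notin> v ` {1..r}" "good (Suc r) w" by blast
    define v' where "v' = v(Suc r := w)"
    have v': "v' (Suc r) = w" "\<And>\<rho>. \<rho> \<in> {1..r} \<Longrightarrow> v' \<rho> = v \<rho>" by (auto simp: v'_def)
    have ins: "{1..Suc r} = insert (Suc r) {1..r}" by auto
    have img: "v' ` {1..r} = v ` {1..r}" using v'(2) by (intro image_cong) auto
    have "inj_on v' {1..r}" using v(1) inj_on_cong[of "{1..r}" v' v] v'(2) by simp
    then have "inj_on v' {1..Suc r}" unfolding ins inj_on_insert using img w(2) v'(1) by simp
    moreover have "v' ` {1..Suc r} \<subseteq> {2..N + 1}"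
      unfolding ins image_insert img v'(1) using v(2) w(1) by simp
    moreover have "\<forall>\<rho>\<in>{1..Suc r}. good \<rho> (v' \<rho>)"
      unfolding ins using v(3) w(3) v' by simp
    ultimately show ?case by blast
  qed auto
  then obtain v where v: "inj_on v {1..N}" "v ` {1..N} \<subseteq> {2..N + 1}" "\<forall>\<rho>\<in>{1..N}. good \<rho> (v \<rho>)"
    by blast
  have "v ` {1..N} = {2..N + 1}"
    using v by (intro card_subset_eq) (auto simp: card_image)
  then have "bij_betw v {1..N} {2..N + 1}" using v by (simp add: bij_betw_def)
  then show ?thesis using that v(3) by (auto simp: good_def)
qed

section \<open>Union bound for Hall's condition\<close>

text \<open>The quotient \<open>s ^ s / s!\<close> is a single term of the exponential series. This
  replaces Stirling's formula in the estimates of binomial coefficients.\<close>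

lemma power_self_le_exp_fact: "real s ^ s \<le> exp s * fact s"
proof -
  have "(\<lambda>n. real s ^ n /\<^sub>R fact n) sums exp (real s)" by (rule exp_converges)
  then have "(\<Sum>n\<in>{s}. real s ^ n /\<^sub>R fact n) \<le> exp (real s)"
    by (intro sum_le_suminf[of _ "{s}", THEN order_trans]) (auto simp: sums_iff)
  then show ?thesis by (simp add: field_simps)
qed

text \<open>The left side consists of two terms of the binomial expansion; it is what the induction
  step of the next lemma produces.\<close>

lemma power_add_ge:
  fixes a b :: real
  assumes "0 \<le> a" "0 \<le> b"
  shows "a ^ Suc t + real (Suc t) * b * a ^ t \<le> (a + b) ^ Suc t"
proof (induction t)
  case (Suc t)
  have "a ^ Suc (Suc t) + real (Suc (Suc t)) * b * a ^ Suc t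
     \<le> (a ^ Suc t + real (Suc t) * b * a ^ t) * (a + b)"
    using assms by (simp add: algebra_simps)
  also have "\<dots> \<le> (a + b) ^ Suc t * (a + b)"
    using Suc assms by (intro mult_right_mono) auto
  finally show ?case by (simp add: mult.commute)
qed simp

text \<open>Expanding the power produces every product over an \<open>s\<close>-element set
  \<open>s!\<close> times, besides other nonnegative terms. It bounds the union over all sets of
  \<open>s\<close> ranks when the probability factorizes over the ranks.\<close>

lemma elementary_symmetric_le:
  fixes a :: "'a \<Rightarrow> real"
  assumes "finite L" "\<And>i. i \<in> L \<Longrightarrow> 0 \<le> a i"
  shows "(\<Sum>S | S \<subseteq> L \<and> card S = s. \<Prod>i\<in>S. a i) \<le> (\<Sum>i\<in>L. a i) ^ s / fact s"
  using assms
proof (induction L arbitrary: s rule: finite_induct)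
  case empty
  have "{S. S \<subseteq> {} \<and> card S = s} = (if s = 0 then {{}} else {} :: 'a set set)" by auto
  then show ?case by simp
next
  case (insert x L)
  let ?A = "\<Sum>i\<in>L. a i"
  have A: "0 \<le> ?A" "0 \<le> a x" using insert by (auto intro: sum_nonneg)
  have fin: "finite {S. S \<subseteq> L \<and> card S = t}" for t using insert by simp
  show ?case
  proof (cases s)
    case 0
    have "{S. S \<subseteq> insert x L \<and> card S = 0} = {{}}"
      using insert(1) by (auto simp: card_eq_0_iff dest: finite_subset)
    then show ?thesis using 0 by simp
  next
    case (Suc t)
    have eq: "{S. S \<subseteq> insert x L \<and> card S = Suc t} =
      {S. S \<subseteq> L \<and> card S = Suc t} \<union> insert x ` {S. S \<subseteq> L \<and> card S = t}"
      (is "?U = ?V \<union> ?W")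
    proof
      show "?U \<subseteq> ?V \<union> ?W"
      proof
        fix S assume S: "S \<in> ?U"
        have finS: "finite S" using S insert(1) by (auto dest: finite_subset)
        show "S \<in> ?V \<union> ?W"
        proof (cases "x \<in> S")
          case True
          then have "S = insert x (S - {x})" "S - {x} \<subseteq> L" "card (S - {x}) = t"
            using S finS by auto
          then show ?thesis by blast
        qed (use S in auto)
      qed
      have "card (insert x S) = Suc t" if "S \<subseteq> L" "card S = t" for S
        using that insert(1,2) by (metis card_insert_disjoint finite_subset subsetD)
      then show "?V \<union> ?W \<subseteq> ?U" by auto
    qed
    have inj: "inj_on (insert x) {S. S \<subseteq> L \<and> card S = t}"
      using insert(2) by (auto simp: inj_on_def)
    have "(\<Sum>S\<in>?U. \<Prod>i\<in>S. a i) = (\<Sum>S\<in>?V. \<Prod>i\<in>S. a i) + (\<Sum>S\<in>?W. \<Prod>i\<in>S. a i)"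
      unfolding eq using fin insert(2) by (intro sum.union_disjoint) auto
    also have "(\<Sum>S\<in>?W. \<Prod>i\<in>S. a i) = (\<Sum>S | S \<subseteq> L \<and> card S = t. \<Prod>i\<in>insert x S. a i)"
      by (simp add: sum.reindex[OF inj])
    also have "\<dots> = (\<Sum>S | S \<subseteq> L \<and> card S = t. a x * (\<Prod>i\<in>S. a i))"
      using insert(1,2) by (intro sum.cong prod.insert) (auto dest: finite_subset)
    also have "\<dots> = a x * (\<Sum>S | S \<subseteq> L \<and> card S = t. \<Prod>i\<in>S. a i)"
      by (simp add: sum_distrib_left)
    also have "(\<Sum>S\<in>?V. \<Prod>i\<in>S. a i) + \<dots> \<le> ?A ^ Suc t / fact (Suc t) + a x * (?A ^ t / fact t)"
      using insert.IH[of "Suc t"] insert.IH[of t] insert.prems A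
      by (intro add_mono mult_left_mono) auto
    also have "\<dots> = (?A ^ Suc t + real (Suc t) * a x * ?A ^ t) / fact (Suc t)"
    proof -
      have "fact (Suc t) = real (Suc t) * fact t" by simp
      then show ?thesis by (simp add: add_divide_distrib mult_ac del: of_nat_Suc fact_Suc)
    qed
    also have "\<dots> \<le> (?A + a x) ^ Suc t / fact (Suc t)"
      using power_add_ge[OF A, of t] by (intro divide_right_mono) auto
    finally show ?thesis using insert(1,2) Suc by (simp add: add.commute)
  qed
qed

lemma binomial_le: "real (n choose k) \<le> real n ^ k / fact k"
proof -
  have "(n choose k) * fact k \<le> n ^ k" by (rule binomial_fact_pow)
  then have "real ((n choose k) * fact k) \<le> real (n ^ k)" by (rule of_nat_mono)
  then show ?thesis by (simp add: field_simps)
qed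

text \<open>
  Number of candidate parents of the vertex of rank \<open>\<rho>\<close>. The harmonic decay keeps the total
  length of the candidate edges of order \<open>sqrt N\<close>, while together they are sufficiently many,
  of order \<open>N * ln N\<close>, to hit every color.
\<close>

definition pick_degree :: "nat \<Rightarrow> nat \<Rightarrow> nat" where
  "pick_degree N \<rho> = min (60 * N div \<rho>) (N + 1 - \<rho>)"

lemma pick_degree_bounds:
  assumes "\<rho> \<in> {1..N}"
  shows "0 < pick_degree N \<rho>" "pick_degree N \<rho> \<le> N + 1 - \<rho>"
    "real (pick_degree N \<rho>) \<le> 60 * real N / real \<rho>" "min 60 (N + 1 - \<rho>) \<le> pick_degree N \<rho>"
proof -
  have "60 * \<rho> \<le> 60 * N" using assms by simp
  then have 60: "60 \<le> 60 * N div \<rho>" using assms by (simp add: less_eq_div_iff_mult_less_eq)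
  show "0 < pick_degree N \<rho>" "pick_degree N \<rho> \<le> N + 1 - \<rho>" "min 60 (N + 1 - \<rho>) \<le> pick_degree N \<rho>"
    using 60 assms unfolding pick_degree_def by auto
  have "real (pick_degree N \<rho>) \<le> real (60 * N div \<rho>)" by (simp add: pick_degree_def)
  also have "\<dots> \<le> real (60 * N) / real \<rho>" by (rule of_nat_div_le_of_nat)
  finally show "real (pick_degree N \<rho>) \<le> 60 * real N / real \<rho>" by simp
qed

lemma pick_degree_antimono:
  assumes "1 \<le> \<rho>" "\<rho> \<le> \<sigma>"
  shows "pick_degree N \<sigma> \<le> pick_degree N \<rho>"
  unfolding pick_degree_def using assms by (intro min.mono div_le_mono2) auto

text \<open>Rounding loses at most one edge, at most \<open>N / \<rho>\<close>, hence 59 in place of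
  60. The cap \<open>N + 1 - \<rho>\<close> does no harm: up to \<open>N / 2\<close> the margin
  \<open>120 \<le> \<rho>\<close> keeps the demand below \<open>N / 2\<close>, and beyond that the
  demand is at most 120.\<close>

lemma pick_degree_ge:
  assumes \<rho>: "120 \<le> \<rho>" "\<rho> + 120 \<le> N"
  shows "59 * real N / real \<rho> \<le> real (pick_degree N \<rho>)"
proof -
  have \<rho>0: "0 < real \<rho>" "real \<rho> \<le> real N" using \<rho> by auto
  have "real (60 * N) / real \<rho> - 1 \<le> real (60 * N div \<rho>)"
  proof -
    have "real (60 * N div \<rho>) = real_of_int \<lfloor>real (60 * N) / real \<rho>\<rfloor>"
      by (simp only: floor_divide_of_nat_eq of_int_of_nat_eq)
    then show ?thesis by linarith
  qed
  moreover have "1 \<le> real N / real \<rho>" using \<rho>0 by simp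
  ultimately have "59 * real N / real \<rho> \<le> real (60 * N div \<rho>)" by simp
  moreover have "59 * real N / real \<rho> \<le> real (N + 1 - \<rho>)"
  proof (cases "2 * \<rho> \<le> N")
    case True
    have "59 * real N / real \<rho> \<le> 60 * real N / 120"
      using \<rho> by (intro frac_le) auto
    also have "\<dots> \<le> real (N + 1 - \<rho>)" using True \<rho> by (simp add: of_nat_diff)
    finally show ?thesis .
  next
    case False
    then have "59 * real N \<le> 120 * real \<rho>" by linarith
    then have "59 * real N / real \<rho> \<le> 120" using \<rho>0 by (simp add: field_simps)
    then show ?thesis using \<rho> by (simp add: of_nat_diff)
  qed
  ultimately show ?thesis by (simp add: pick_degree_def)
qed

lemma harmonic_interval_ge:
  assumes "0 < a" "a \<le> b"
  shows "ln (real b / real a) \<le> (\<Sum>\<rho>=a..<b. 1 / real \<rho>)"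
  using assms(2)
proof (induction b rule: dec_induct)
  case (step b)
  have b: "0 < real b" using step assms by simp
  have "ln (real (Suc b) / real a) = ln (real b / real a) + ln (1 + 1 / real b)"
  proof -
    have "real (Suc b) / real a = (real b / real a) * (1 + 1 / real b)" using b assms by (simp add: field_simps)
    then have "ln (real (Suc b) / real a) = ln ((real b / real a) * (1 + 1 / real b))" by (rule arg_cong)
    also have "\<dots> = ln (real b / real a) + ln (1 + 1 / real b)" using b assms by (intro ln_mult_pos) (auto intro: add_pos_pos)
    finally show ?thesis .
  qed
  also have "ln (1 + 1 / real b) \<le> 1 / real b" using b by (intro ln_add_one_self_le_self) simp
  finally show ?case using step by simp
qed (use assms in simp)

text \<open>Degrees decrease with the rank, so among sets of this size the interval
  \<open>{u..N}\<close> has the least total degree; exchanging \<open>P\<close> for \<open>Q\<close>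
  shows it. On that interval, trimmed by 120 at both ends, the sum is harmonic and yields the
  logarithm.\<close>

lemma sum_pick_degree_ge:
  assumes S: "S \<subseteq> {1..N}" "card S = N + 1 - u" and u: "1 \<le> u" "u \<le> N" "u + 240 \<le> N" "480 \<le> N"
  shows "59 * real N * ln ((3 / 4 * real N) / (real u + 120)) \<le> real (\<Sum>\<rho>\<in>S. pick_degree N \<rho>)"
proof -
  let ?d = "pick_degree N"
  have finS: "finite S" using S finite_subset by blast
  define P where "P = {u..N} - S"
  define Q where "Q = S - {u..N}"
  have "card {u..N} = card S" using S u by simp
  then have card: "card P = card Q" unfolding P_def Q_def
    using card_Diff_subset_Int[of "{u..N}" S] card_Diff_subset_Int[of S "{u..N}"] finS
    by (simp add: Int_commute)
  have "sum ?d P \<le> (\<Sum>\<rho>\<in>P. ?d u)"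
    unfolding P_def using u by (intro sum_mono pick_degree_antimono) auto
  also have "\<dots> = (\<Sum>\<rho>\<in>Q. ?d u)" using card by simp
  also have "\<dots> \<le> sum ?d Q"
    unfolding Q_def using S by (intro sum_mono pick_degree_antimono) auto
  finally have PQ: "sum ?d P \<le> sum ?d Q" .
  have "sum ?d {u..N} = sum ?d P + sum ?d (S \<inter> {u..N})"
    unfolding P_def by (subst sum.union_disjoint[symmetric]) (auto intro: sum.cong)
  also have "\<dots> \<le> sum ?d Q + sum ?d (S \<inter> {u..N})" using PQ by simp
  also have "\<dots> = sum ?d S"
    unfolding Q_def using finS by (subst sum.union_disjoint[symmetric]) (auto intro: sum.cong)
  finally have 1: "sum ?d {u..N} \<le> sum ?d S" .
  \<comment> \<open>Here \<open>480 \<le> N\<close> makes the trimmed upper end at least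
    \<open>3 / 4 * N\<close>.\<close>
  have "ln ((3 / 4 * real N) / (real u + 120)) \<le> ln (real (N - 119) / real (u + 120))"
    unfolding of_nat_add of_nat_numeral
    using u by (intro ln_mono divide_right_mono divide_pos_pos) (auto simp: of_nat_diff)
  also have "\<dots> \<le> (\<Sum>\<rho>=u+120..<N-119. 1 / real \<rho>)"
    using u by (intro harmonic_interval_ge) auto
  finally have "59 * real N * ln ((3 / 4 * real N) / (real u + 120)) \<le>
     59 * real N * (\<Sum>\<rho>=u+120..<N-119. 1 / real \<rho>)" by (intro mult_left_mono) auto
  also have "\<dots> = (\<Sum>\<rho>=u+120..<N-119. 59 * real N / real \<rho>)" by (simp add: sum_distrib_left)
  also have "\<dots> \<le> (\<Sum>\<rho>=u+120..<N-119. real (?d \<rho>))"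
    by (intro sum_mono pick_degree_ge) auto
  also have "\<dots> \<le> (\<Sum>\<rho>=u..N. real (?d \<rho>))" by (intro sum_mono2) auto
  also have "\<dots> = real (sum ?d {u..N})" by simp
  also have "\<dots> \<le> real (sum ?d S)" using 1 by (intro of_nat_mono)
  finally show ?thesis .
qed

text \<open>The part of the union bound due to sets of \<open>s\<close> ranks: Hall's condition
  fails at \<open>S\<close> if some set of \<open>s - 1\<close> colors contains the colors of all
  candidate edges of \<open>S\<close>. The binomial coefficient counts these color sets.\<close>

definition hall_term :: "nat \<Rightarrow> nat \<Rightarrow> real" where
  "hall_term N s = (\<Sum>S | S \<subseteq> {1..N} \<and> card S = s.
     real (N choose (s - 1)) * (real (s - 1) / real N) ^ (\<Sum>\<rho>\<in>S. pick_degree N \<rho>))"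

text \<open>Replacing \<open>s - 1\<close> by \<open>s\<close> in the base makes the weight a
  product over the ranks in \<open>S\<close>, so the elementary symmetric bound applies with
  \<open>q = s / N\<close>. Two estimates by \<open>exp s\<close> then absorb the
  factorials.\<close>

lemma hall_term_small:
  assumes s: "1 \<le> s" "2 * s \<le> N"
  shows "hall_term N s \<le> 1 / real N * (real s * (exp 2 * (2 / real s + (1 / 2) ^ 58)) ^ s)"
proof -
  define q where "q = real s / real N"
  have N: "0 < real N" and s0: "0 < real s" using s by auto
  have q: "0 < q" "q \<le> 1 / 2" using s by (auto simp: q_def field_simps)
  have Nq: "real N * q = real s" using N by (simp add: q_def)
  have "(\<Sum>\<rho>\<in>{1..N}. q ^ pick_degree N \<rho>) \<le> (\<Sum>\<rho>\<in>{1..N}. q ^ 60 + q ^ (N + 1 - \<rho>))"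
  proof (rule sum_mono)
    fix \<rho> assume \<rho>: "\<rho> \<in> {1..N}"
    \<comment> \<open>Degrees below 60 occur only where the cap binds, at the last ranks. These
      contribute a geometric series, all ranks together at most \<open>N * q ^ 60\<close>
      more.\<close>
    have "q ^ pick_degree N \<rho> \<le> q ^ min 60 (N + 1 - \<rho>)"
      using q pick_degree_bounds(4)[OF \<rho>] by (intro power_decreasing) auto
    also have "\<dots> \<le> q ^ 60 + q ^ (N + 1 - \<rho>)" using q by (auto simp: min_def)
    finally show "q ^ pick_degree N \<rho> \<le> q ^ 60 + q ^ (N + 1 - \<rho>)" .
  qed
  also have "\<dots> = real N * q ^ 60 + (\<Sum>\<rho>\<in>{1..N}. q ^ (N + 1 - \<rho>))" by (simp add: sum.distrib)
  also have "(\<Sum>\<rho>\<in>{1..N}. q ^ (N + 1 - \<rho>)) = (\<Sum>m\<in>{1..N}. q ^ m)"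
    by (rule sum.reindex_bij_witness[of _ "\<lambda>m. N + 1 - m" "\<lambda>m. N + 1 - m"]) auto
  also have "\<dots> = q * (\<Sum>m<N. q ^ m)"
    by (simp add: sum_distrib_left sum.atLeast1_atMost_eq)
  also have "(\<Sum>m<N. q ^ m) \<le> 2"
  proof -
    have "(\<Sum>m<N. q ^ m) = (1 - q ^ N) / (1 - q)" using q by (simp add: sum_gp_strict)
    also have "\<dots> \<le> 1 / (1 - q)" using q by (intro divide_right_mono) auto
    also have "\<dots> \<le> 2" using q by (simp add: field_simps)
    finally show ?thesis .
  qed
  also have "real N * q ^ 60 + q * 2 = q * (2 + real s * q ^ 58)"
    by (simp add: Nq[symmetric] field_simps power_numeral_reduce)
  also have "\<dots> \<le> q * (2 + real s * (1 / 2) ^ 58)"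
    using q by (intro mult_left_mono add_left_mono power_mono) auto
  finally have sum_q: "(\<Sum>\<rho>\<in>{1..N}. q ^ pick_degree N \<rho>) \<le> q * (2 + real s * (1 / 2) ^ 58)"
    using q by (simp add: mult_left_mono)
  define c where "c = 2 / real s + (1 / 2 :: real) ^ 58"
  have c: "0 \<le> c" by (simp add: c_def)
  have qc: "q * (2 + real s * (1 / 2) ^ 58) = q * real s * c" using s0 by (simp add: c_def field_simps)
  have choose: "real (N choose (s - 1)) \<le> real N ^ (s - 1) / fact (s - 1)" by (rule binomial_le)
  have "hall_term N s \<le> (\<Sum>S | S \<subseteq> {1..N} \<and> card S = s.
     real N ^ (s - 1) / fact (s - 1) * (\<Prod>\<rho>\<in>S. q ^ pick_degree N \<rho>))"
    unfolding hall_term_def power_sum[symmetric] using choose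
    by (intro sum_mono mult_mono power_mono) (auto simp: q_def divide_right_mono)
  also have "\<dots> = real N ^ (s - 1) / fact (s - 1) *
     (\<Sum>S | S \<subseteq> {1..N} \<and> card S = s. \<Prod>\<rho>\<in>S. q ^ pick_degree N \<rho>)"
    by (simp add: sum_distrib_left)
  also have "\<dots> \<le> real N ^ (s - 1) / fact (s - 1) *
     ((\<Sum>\<rho>\<in>{1..N}. q ^ pick_degree N \<rho>) ^ s / fact s)"
    using q by (intro mult_left_mono elementary_symmetric_le) auto
  also have "\<dots> \<le> real N ^ (s - 1) / fact (s - 1) * ((q * real s * c) ^ s / fact s)"
    using q sum_q by (intro mult_left_mono divide_right_mono power_mono) (auto simp: qc intro: sum_nonneg)
  \<comment> \<open>There are \<open>s\<close> powers of \<open>q\<close> but only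
    \<open>s - 1\<close> of \<open>N\<close>, since the color set is smaller than \<open>S\<close>
    by one. With \<open>N * q = s\<close> this leaves the decisive factor
    \<open>1 / N\<close>.\<close>
  also have "\<dots> = 1 / real N * (real s * (real s ^ s / fact s) * (real s ^ s / fact s) * c ^ s)"
  proof -
    obtain t where t: "s = Suc t" using s by (cases s) auto
    have "real N * (real N ^ t * (q * r * c) ^ Suc t) = (real N * q) ^ Suc t * r ^ Suc t * c ^ Suc t" for r
      by (simp add: power_mult_distrib mult_ac)
    from this[of "real s"]
    have "real N ^ (s - 1) * (q * real s * c) ^ s = 1 / real N * ((real N * q) ^ s * real s ^ s * c ^ s)"
      using N unfolding t diff_Suc_1 by (metis mult_1 nonzero_mult_div_cancel_left times_divide_eq_left less_numeral_extra(3))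
    note 1 = this
    have 2: "fact (s - 1) = (fact s :: real) / real s" using t by simp
    have "real N ^ (s - 1) / fact (s - 1) * ((q * real s * c) ^ s / fact s)
      = (real N ^ (s - 1) * (q * real s * c) ^ s) / (fact (s - 1) * fact s)" by simp
    also have "\<dots> = 1 / real N * (real s ^ s * real s ^ s * c ^ s) / (fact s / real s * fact s)"
      by (simp only: 1 2 Nq)
    also have "\<dots> = 1 / real N * (real s * (real s ^ s / fact s) * (real s ^ s / fact s) * c ^ s)"
      by simp
    finally show ?thesis .
  qed
  also have "\<dots> \<le> 1 / real N * (real s * exp s * exp s * c ^ s)"
    using power_self_le_exp_fact[of s] c
    by (intro mult_left_mono mult_right_mono mult_mono) (auto simp: field_simps)
  also have "real s * exp s * exp s * c ^ s = real s * (exp 2 * c) ^ s"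
    by (simp add: power_mult_distrib exp_of_nat_mult[symmetric] exp_add[symmetric])
  finally show ?thesis by (simp add: c_def)
qed

text \<open>Here \<open>u\<close> colors are avoided and \<open>S\<close> omits only
  \<open>u - 1\<close> ranks, so the total degree of \<open>S\<close> is of coupon collector size.
  Avoiding \<open>u\<close> colors then has probability at most
  \<open>(4 / 3 * y) ^ (59 * u)\<close>, which outweighs the choices of ranks and of colors, at most
  \<open>W\<close> each.\<close>

lemma hall_term_large:
  assumes N: "13000 \<le> N" and u: "1 \<le> u" "2 * u \<le> N + 1"
  shows "hall_term N (N + 1 - u) \<le> 1 / real N * (121 * real u * (1 / 2) ^ u)"
proof -
  define y where "y = (real u + 120) / real N"
  have N0: "0 < real N" and u0: "0 < real u" using N u by auto
  have uN: "u \<le> N" "u + 240 \<le> N" using N u by auto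
  \<comment> \<open>The threshold 13000 makes \<open>120.5 / N\<close> at most 0.01, so
    \<open>y \<le> 0.51\<close>; the factor 121 comes from \<open>1 \<le> u\<close>.\<close>
  have y: "0 < y" "y \<le> 51 / 100" "y \<le> 121 * (real u / real N)"
    using N u by (auto simp: y_def field_simps)
  define M where "M = 59 * real N * ln ((3 / 4 * real N) / (real u + 120))"
  have M: "exp (- (real u / real N) * M) = (4 / 3 * y) ^ (59 * u)"
  proof -
    have "- (real u / real N) * M = real (59 * u) * (- ln ((3 / 4 * real N) / (real u + 120)))"
      using N0 by (simp add: M_def)
    also have "- ln ((3 / 4 * real N) / (real u + 120)) = ln (4 / 3 * y)"
      using N0 u0 by (subst ln_inverse[symmetric]) (auto simp: y_def)
    finally show ?thesis using y by (simp only: exp_of_nat_mult) simp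
  qed
  define W where "W = (exp 1 * real N / real u) ^ u"
  have W0: "0 \<le> W" by (simp add: W_def)
  have pow: "real N ^ u / fact u \<le> W"
    using power_self_le_exp_fact[of u] u0 N0
    by (simp add: W_def power_divide power_mult_distrib exp_of_nat_mult[symmetric] field_simps)
  have choose_u: "real (N choose u) \<le> W" using binomial_le[of N u] pow by linarith
  have choose_u': "real (N choose (u - 1)) \<le> W"
  proof -
    obtain t where t: "u = Suc t" using u by (cases u) auto
    have "real (N choose (u - 1)) \<le> real N ^ t / fact t" using binomial_le[of N t] t by simp
    also have "\<dots> = real N ^ t * real u / fact u" using t by (simp del: of_nat_Suc add: field_simps)
    also have "\<dots> \<le> real N ^ t * real N / fact u"
      using uN by (intro divide_right_mono mult_left_mono) auto
    also have "\<dots> = real N ^ u / fact u" using t by simp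
    finally show ?thesis using pow by simp
  qed
  let ?s = "N + 1 - u"
  have s: "?s - 1 = N - u" "real (N - u) / real N = 1 - real u / real N"
    using uN N0 by (auto simp: of_nat_diff field_simps)
  have pow_le: "(real (?s - 1) / real N) ^ (\<Sum>\<rho>\<in>S. pick_degree N \<rho>) \<le> (4 / 3 * y) ^ (59 * u)"
    if S: "S \<subseteq> {1..N}" "card S = ?s" for S
  proof -
    have "M \<le> real (\<Sum>\<rho>\<in>S. pick_degree N \<rho>)" (is "_ \<le> real ?d")
      unfolding M_def using S u uN N by (intro sum_pick_degree_ge) auto
    have "(1 - real u / real N) ^ ?d \<le> exp (- (real u / real N)) ^ ?d"
      using uN N0 exp_ge_add_one_self[of "- (real u / real N)"] by (intro power_mono) auto
    also have "\<dots> = exp (- (real u / real N) * real ?d)"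
      by (simp only: exp_of_nat_mult[symmetric] mult.commute)
    also have "\<dots> \<le> exp (- (real u / real N) * M)"
      using mult_left_mono[OF \<open>M \<le> real ?d\<close>, of "real u / real N"] by (simp only: exp_le_cancel_iff) simp
    finally show ?thesis by (simp only: s M)
  qed
  have "hall_term N ?s \<le> (\<Sum>S | S \<subseteq> {1..N} \<and> card S = ?s. W * (4 / 3 * y) ^ (59 * u))"
    unfolding hall_term_def
  proof (intro sum_mono mult_mono)
    show "real (N choose (?s - 1)) \<le> W"
      using choose_u binomial_symmetric[OF uN(1)] s by simp
  qed (use pow_le W0 in auto)
  also have "\<dots> = real (N choose ?s) * (W * (4 / 3 * y) ^ (59 * u))"
    by (simp add: n_subsets)
  also have "N choose ?s = N choose (u - 1)"
    using binomial_symmetric[of "u - 1" N] u uN by simp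
  also have "real (N choose (u - 1)) * (W * (4 / 3 * y) ^ (59 * u)) \<le> W * (W * (4 / 3 * y) ^ (59 * u))"
    using choose_u' W0 y by (intro mult_right_mono) auto
  also have "\<dots> = ((exp 1 * real N / real u)\<^sup>2 * (4 / 3 * y) ^ 59) ^ u"
    by (simp only: W_def power_mult_distrib power_mult power2_eq_square mult.assoc)
  also have "\<dots> \<le> (1 / 2 * y) ^ u"
  proof (rule power_mono)
    have "exp (1::real) * exp 1 \<le> 3 * 3" using exp_le by (intro mult_mono) auto
    then have e2: "(exp 1 :: real)\<^sup>2 \<le> 9" by (simp add: power2_eq_square)
    have "y * (real N / real u) \<le> 121" using y(3) u0 N0 by (simp add: field_simps)
    then have yNu: "(y * (real N / real u))\<^sup>2 \<le> 121\<^sup>2"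
      using y N0 u0 by (intro power_mono) auto
    \<comment> \<open>The exponent is split as \<open>59 = 2 + 1 + 56\<close>: two factors
      \<open>y\<close> cancel \<open>(N / u)\<^sup>2\<close> up to \<open>121\<^sup>2\<close>, one
      is kept, and 56 factors of at most 0.68 beat all constants.\<close>
    have "(exp 1 * real N / real u)\<^sup>2 * (4 / 3 * y) ^ 59
        = (exp 1)\<^sup>2 * (y * (real N / real u))\<^sup>2 * ((4 / 3) ^ 3 * ((4 / 3 * y) ^ 56 * y))"
      by (simp add: power_mult_distrib power_divide power_numeral_reduce)
    also have "\<dots> \<le> 9 * 121\<^sup>2 * ((4 / 3) ^ 3 * ((68 / 100) ^ 56 * y))"
    proof -
      have "(4 / 3 * y) ^ 56 \<le> (68 / 100) ^ 56" using y by (intro power_mono) auto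
      then show ?thesis using e2 yNu y by (intro mult_mono mult_left_mono mult_right_mono) auto
    qed
    also have "\<dots> = (9 * 121\<^sup>2 * (4 / 3) ^ 3 * (68 / 100) ^ 56) * y" by simp
    also have "\<dots> \<le> 1 / 2 * y" using y by (intro mult_right_mono) (auto simp: power_divide)
    finally show "(exp 1 * real N / real u)\<^sup>2 * (4 / 3 * y) ^ 59 \<le> 1 / 2 * y" .
  qed (use y in auto)
  also have "\<dots> \<le> (1 / 2) ^ u * y"
  proof -
    \<comment> \<open>A single \<open>y\<close> is retained: it is at most
      \<open>121 * u / N\<close> and supplies the factor \<open>1 / N\<close>.\<close>
    have "y ^ u \<le> y ^ 1" using y u by (intro power_decreasing) auto
    then have "(1 / 2) ^ u * y ^ u \<le> (1 / 2) ^ u * y" by (intro mult_left_mono) auto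
    then show ?thesis by (simp only: power_mult_distrib)
  qed
  also have "\<dots> \<le> (1 / 2) ^ u * (121 * (real u / real N))" using y by (intro mult_left_mono) auto
  finally show ?thesis by (simp add: mult_ac)
qed

text \<open>Small sets fail by sharing too few colors, large ones by leaving colors out; the latter
  are indexed by \<open>u = N + 1 - s\<close>. In both ranges the bound is \<open>1 / N\<close>
  times a term of a convergent series that does not depend on \<open>N\<close>.\<close>

lemma sum_hall_term_le:
  obtains C :: real where "\<And>N. 13000 \<le> N \<Longrightarrow> (\<Sum>s=1..N. hall_term N s) \<le> C / real N"
proof -
  define g where "g s = real s * (exp 2 * (2 / real s + (1 / 2) ^ 58)) ^ s" for s
  define h where "h u = 121 * real u * (1 / 2 :: real) ^ u" for u
  have half: "summable (\<lambda>n. real n * (1 / 2) ^ n)"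
  proof (rule summable_comparison_test)
    show "summable (\<lambda>n. of_nat (Suc n) * (1 / 2 :: real) ^ n)"
      using geometric_deriv_sums[of "1 / 2 :: real"] by (simp add: sums_iff)
  qed auto
  have g: "summable g"
  proof (rule summable_comparison_test_ev[OF _ half], rule eventually_sequentiallyI[of 60])
    fix s :: nat assume s: "60 \<le> s"
    have "exp (2::real) = exp 1 * exp 1" by (simp add: exp_add[symmetric])
    also have "\<dots> \<le> 3 * 3" using exp_le by (intro mult_mono) auto
    \<comment> \<open>From \<open>s = 60\<close> on, the base drops below \<open>1 / 2\<close>, with
      9 as a bound for \<open>exp 2\<close>.\<close>
    finally have "exp (2::real) * (2 / real s + (1 / 2) ^ 58) \<le> 9 * (2 / 60 + 1 / 60)"
      using s by (intro mult_mono add_mono divide_left_mono) (auto simp: power_divide)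
    also have "\<dots> \<le> 1 / 2" by simp
    finally have "(exp 2 * (2 / real s + (1 / 2) ^ 58)) ^ s \<le> (1 / 2) ^ s"
      by (intro power_mono mult_nonneg_nonneg add_nonneg_nonneg) (auto simp del: mult_numeral_1)
    then show "norm (g s) \<le> real s * (1 / 2) ^ s"
      unfolding g_def by (simp add: mult_left_mono)
  qed
  have h: "summable h" unfolding h_def mult.assoc by (intro summable_mult half)
  have g0: "0 \<le> g s" and h0: "0 \<le> h s" for s by (auto simp: g_def h_def)
  show ?thesis
  proof
    fix N :: nat assume N: "13000 \<le> N"
    let ?L = "{s\<in>{1..N}. 2 * s \<le> N}" and ?R = "{s\<in>{1..N}. N < 2 * s}"
    have "(\<Sum>s=1..N. hall_term N s) = sum (hall_term N) ?L + sum (hall_term N) ?R"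
      by (subst sum.union_disjoint[symmetric]) (auto intro: sum.cong)
    also have "sum (hall_term N) ?L \<le> (\<Sum>s\<in>?L. 1 / real N * g s)"
      unfolding g_def by (intro sum_mono hall_term_small) auto
    also have "\<dots> = 1 / real N * sum g ?L" by (simp add: sum_distrib_left)
    also have "\<dots> \<le> 1 / real N * suminf g"
      using g g0 by (intro mult_left_mono sum_le_suminf) auto
    also have "sum (hall_term N) ?R \<le> (\<Sum>s\<in>?R. 1 / real N * h (N + 1 - s))"
    proof (rule sum_mono)
      fix s assume "s \<in> ?R"
      then have "N + 1 - (N + 1 - s) = s" "1 \<le> N + 1 - s" "2 * (N + 1 - s) \<le> N + 1" by auto
      then show "hall_term N s \<le> 1 / real N * h (N + 1 - s)"
        using hall_term_large[OF N, of "N + 1 - s"] by (simp only: h_def)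
    qed
    also have "\<dots> = 1 / real N * (\<Sum>s\<in>?R. h (N + 1 - s))" by (simp add: sum_distrib_left)
    also have "(\<Sum>s\<in>?R. h (N + 1 - s)) = sum h ((\<lambda>s. N + 1 - s) ` ?R)"
      by (subst sum.reindex) (auto simp: inj_on_def)
    also have "1 / real N * sum h ((\<lambda>s. N + 1 - s) ` ?R) \<le> 1 / real N * suminf h"
      using h h0 by (intro mult_left_mono sum_le_suminf) auto
    finally show "(\<Sum>s=1..N. hall_term N s) \<le> (suminf g + suminf h) / real N"
      by (simp add: add_divide_distrib)
  qed
qed

section \<open>Random colors\<close>

lemma (in prob_space) sets_card_le:
  assumes I: "finite I" and A: "\<And>i. i \<in> I \<Longrightarrow> A i \<in> events"
  shows "{\<omega>\<in>space M. real (card {i\<in>I. \<omega> \<in> A i}) \<le> a} \<in> events"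
proof -
  have "(\<lambda>\<omega>. \<Sum>i\<in>I. indicator (A i) \<omega> :: real) \<in> borel_measurable M" using A by measurable
  moreover have "(\<Sum>i\<in>I. indicator (A i) \<omega> :: real) = real (card {i\<in>I. \<omega> \<in> A i})" for \<omega>
    using I by (simp add: indicator_def sum.If_cases Int_def)
  ultimately have "(\<lambda>\<omega>. real (card {i\<in>I. \<omega> \<in> A i})) \<in> borel_measurable M" by simp
  then show ?thesis by measurable
qed

text \<open>The second moment of the count is \<mu> plus the sum over pairs, so its variance is at
  most \<open>\<mu> + \<delta> * \<mu>\<^sup>2\<close>, and Chebyshev's inequality applies. The
  tolerance \<delta> for positive correlation is 0 for missed colors and of order
  \<open>1 / n\<close> for pairs of points.\<close>

lemma (in prob_space) count_lower_tail:
  assumes I: "finite I" and A: "\<And>i. i \<in> I \<Longrightarrow> A i \<in> events"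
    and \<mu>: "\<mu> = (\<Sum>i\<in>I. prob (A i))"
    and pair: "(\<Sum>i\<in>I. \<Sum>j\<in>I - {i}. prob (A i \<inter> A j)) \<le> (1 + \<delta>) * \<mu>\<^sup>2"
    and t: "0 < t"
  shows "prob {\<omega>\<in>space M. real (card {i\<in>I. \<omega> \<in> A i}) \<le> \<mu> - t} \<le> (\<mu> + \<delta> * \<mu>\<^sup>2) / t\<^sup>2"
proof -
  define W where "W \<omega> = (\<Sum>i\<in>I. indicator (A i) \<omega> :: real)" for \<omega>
  have W_card: "W \<omega> = real (card {i\<in>I. \<omega> \<in> A i})" for \<omega>
    unfolding W_def using I by (simp add: indicator_def sum.If_cases Int_def)
  have int: "integrable M (\<lambda>\<omega>. indicator (A i \<inter> A j) \<omega> :: real)" if "i \<in> I" "j \<in> I" for i j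
    using A that by (intro integrable_real_indicator) (auto simp: emeasure_eq_measure)
  have int1: "integrable M (\<lambda>\<omega>. indicator (A i) \<omega> :: real)" if "i \<in> I" for i
    using int[OF that that] by simp
  have meas: "W \<in> borel_measurable M" unfolding W_def using int1 by auto
  have EW: "expectation W = \<mu>"
    unfolding W_def \<mu> using int1 A by (simp add: Bochner_Integration.integral_sum)
  have W2: "(W \<omega>)\<^sup>2 = (\<Sum>i\<in>I. \<Sum>j\<in>I. indicator (A i \<inter> A j) \<omega>)" for \<omega>
    by (simp add: W_def power2_eq_square sum_product indicator_inter_arith)
  have intW2: "integrable M (\<lambda>\<omega>. (W \<omega>)\<^sup>2)"
    unfolding W2 using int by (intro Bochner_Integration.integrable_sum) auto
  have intW: "integrable M W" unfolding W_def using int1 by (intro Bochner_Integration.integrable_sum) auto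
  have "expectation (\<lambda>\<omega>. (W \<omega>)\<^sup>2) = (\<Sum>i\<in>I. \<Sum>j\<in>I. prob (A i \<inter> A j))"
    unfolding W2 using int A by (simp add: Bochner_Integration.integral_sum)
  also have "\<dots> = (\<Sum>i\<in>I. prob (A i) + (\<Sum>j\<in>I - {i}. prob (A i \<inter> A j)))"
    using I by (intro sum.cong refl) (subst sum.remove, auto)
  also have "\<dots> \<le> \<mu> + (1 + \<delta>) * \<mu>\<^sup>2" using pair by (simp add: sum.distrib \<mu>)
  finally have "variance W \<le> \<mu> + \<delta> * \<mu>\<^sup>2"
    using variance_eq[OF intW intW2] EW by (simp add: algebra_simps)
  then have "variance W / t\<^sup>2 \<le> (\<mu> + \<delta> * \<mu>\<^sup>2) / t\<^sup>2" by (intro divide_right_mono) auto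
  moreover have "prob {\<omega>\<in>space M. t \<le> \<bar>W \<omega> - expectation W\<bar>} \<le> variance W / t\<^sup>2"
    using meas intW2 t by (rule Chebyshev_inequality)
  moreover have "prob {\<omega>\<in>space M. W \<omega> \<le> \<mu> - t} \<le> prob {\<omega>\<in>space M. t \<le> \<bar>W \<omega> - expectation W\<bar>}"
    using meas EW by (intro finite_measure_mono) auto
  ultimately show ?thesis by (simp only: W_card)
qed

lemma measure_PiM_box:
  assumes "prob_space M" "finite I" "\<And>i. i \<in> I \<Longrightarrow> A i \<in> sets M"
  shows "measure (\<Pi>\<^sub>M i\<in>I. M) (Pi\<^sub>E I A) = (\<Prod>i\<in>I. measure M (A i))"
proof -
  interpret M: prob_space M by fact
  interpret finite_product_prob_space "\<lambda>_. M" I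
    by unfold_locales (rule assms)
  show ?thesis using assms by (intro finite_measure_PiM_emb) auto
qed

section \<open>Uniform colorings and repeated colors\<close>

definition color_space :: "'e set \<Rightarrow> nat \<Rightarrow> ('e \<Rightarrow> nat) measure" where
  "color_space E N = (\<Pi>\<^sub>M e\<in>E. uniform_count_measure {1..N})"

lemma space_color_space: "space (color_space E N) = E \<rightarrow>\<^sub>E {1..N}"
  by (simp add: color_space_def space_PiM space_uniform_count_measure)

lemma prob_space_color_space:
  assumes "0 < N"
  shows "prob_space (color_space E N)"
  unfolding color_space_def using assms
  by (intro prob_space_PiM prob_space_uniform_count_measure) auto

text \<open>There are only finitely many colorings and each singleton is a box, so no event about
  colors needs its own measurability proof.\<close>

lemma sets_color_space:
  assumes "finite E" "A \<subseteq> E \<rightarrow>\<^sub>E {1..N}"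
  shows "A \<in> sets (color_space E N)"
proof -
  have "{c} \<in> sets (color_space E N)" if "c \<in> A" for c
  proof -
    have c: "c \<in> E \<rightarrow>\<^sub>E {1..N}" using that assms by auto
    then have "{c} = Pi\<^sub>E E (\<lambda>e. {c e})" by (metis PiE_restrict PiE_singleton PiE_mem PiE_iff)
    moreover have "Pi\<^sub>E E (\<lambda>e. {c e}) \<in> sets (color_space E N)"
      unfolding color_space_def using assms c
      by (intro sets_PiM_I_finite) (auto simp: sets_uniform_count_measure_count_space)
    ultimately show ?thesis by simp
  qed
  moreover have "finite A" using assms finite_PiE[of E "\<lambda>_. {1..N}"] finite_subset by auto
  moreover have "A = (\<Union>c\<in>A. {c})" by auto
  ultimately show ?thesis by (metis sets.finite_UN)
qed

lemma prob_colors_in: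
  assumes E: "finite E" "K \<subseteq> E" and T: "T \<subseteq> {1..N}" and N: "0 < N"
  shows "measure (color_space E N) {c \<in> space (color_space E N). c ` K \<subseteq> T} = (real (card T) / real N) ^ card K"
proof -
  have prob: "prob_space (uniform_count_measure {1..N})"
    using N by (intro prob_space_uniform_count_measure) auto
  have "{c \<in> space (color_space E N). c ` K \<subseteq> T} = Pi\<^sub>E E (\<lambda>e. if e \<in> K then T else {1..N})"
  proof (intro set_eqI iffI)
    fix c assume "c \<in> {c \<in> space (color_space E N). c ` K \<subseteq> T}"
    then show "c \<in> Pi\<^sub>E E (\<lambda>e. if e \<in> K then T else {1..N})"
      unfolding space_color_space by (intro PiE_I) auto
  next
    fix c assume c: "c \<in> Pi\<^sub>E E (\<lambda>e. if e \<in> K then T else {1..N})"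
    have "c e \<in> (if e \<in> K then T else {1..N})" if "e \<in> E" for e using PiE_mem[OF c that] .
    then have "c e \<in> {1..N}" "e \<in> K \<longrightarrow> c e \<in> T" if "e \<in> E" for e
      using that T by (metis subsetD)+
    moreover have "c e = undefined" if "e \<notin> E" for e using PiE_arb[OF c that] .
    ultimately show "c \<in> {c \<in> space (color_space E N). c ` K \<subseteq> T}"
      unfolding space_color_space using E by (auto intro!: PiE_I)
  qed
  then have "measure (color_space E N) {c \<in> space (color_space E N). c ` K \<subseteq> T} =
    (\<Prod>e\<in>E. measure (uniform_count_measure {1..N}) (if e \<in> K then T else {1..N}))"
    unfolding color_space_def
    using measure_PiM_box[OF prob E(1), of "\<lambda>e. if e \<in> K then T else {1..N}"] T
    by (auto simp: sets_uniform_count_measure_count_space)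
  also have "\<dots> = (\<Prod>e\<in>E. if e \<in> K then real (card T) / real N else 1)"
    using T N by (intro prod.cong) (auto simp: measure_uniform_count_measure)
  also have "\<dots> = (real (card T) / real N) ^ card K"
    using E by (simp add: prod.If_cases Int_absorb1)
  finally show ?thesis .
qed

text \<open>Without distinct representatives, Hall's theorem gives a set \<open>S\<close> of ranks
  whose colors fit into a set \<open>T\<close> of \<open>card S - 1\<close> colors. The candidate
  sets are disjoint, so the number of independent colors forced into \<open>T\<close> is the total
  degree of \<open>S\<close>.\<close>

lemma prob_no_distinct_colors:
  assumes E: "finite E" and N: "0 < N"
    and F: "\<And>\<rho>. \<rho> \<in> {1..N} \<Longrightarrow> F \<rho> \<subseteq> E \<and> card (F \<rho>) = pick_degree N \<rho>"
    and disj: "disjoint_family_on F {1..N}"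
  shows "measure (color_space E N) {c \<in> space (color_space E N).
      \<not> (\<exists>f. (\<forall>\<rho>\<in>{1..N}. f \<rho> \<in> c ` F \<rho>) \<and> inj_on f {1..N})} \<le> (\<Sum>s=1..N. hall_term N s)"
proof -
  let ?M = "color_space E N"
  interpret prob_space ?M using N by (rule prob_space_color_space)
  define B where "B S T = {c \<in> space ?M. c ` (\<Union> (F ` S)) \<subseteq> T}" for S T
  define J where "J = (SIGMA s:{1..N}. {S. S \<subseteq> {1..N} \<and> card S = s} \<times> {T. T \<subseteq> {1..N} \<and> card T = s - 1})"
  have ev: "A \<in> events" if "A \<subseteq> space ?M" for A
    using that E by (intro sets_color_space) (auto simp: space_color_space)
  have finJ: "finite J" by (auto simp: J_def)
  have "{c \<in> space ?M. \<not> (\<exists>f. (\<forall>\<rho>\<in>{1..N}. f \<rho> \<in> c ` F \<rho>) \<and> inj_on f {1..N})}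
      \<subseteq> (\<Union>(s, S, T)\<in>J. B S T)"
  proof
    fix c assume c: "c \<in> {c \<in> space ?M. \<not> (\<exists>f. (\<forall>\<rho>\<in>{1..N}. f \<rho> \<in> c ` F \<rho>) \<and> inj_on f {1..N})}"
    then have c_space: "c \<in> space ?M" by simp
    have finF: "finite (F \<rho>)" if "\<rho> \<in> {1..N}" for \<rho> using F[OF that] E finite_subset by blast
    have "\<not> (\<forall>S\<subseteq>{1..N}. card S \<le> card (\<Union>\<rho>\<in>S. c ` F \<rho>))"
      using c finF hall_marriage[of "{1..N}" "\<lambda>\<rho>. c ` F \<rho>"] by blast
    then obtain S where S: "S \<subseteq> {1..N}" "card (\<Union>\<rho>\<in>S. c ` F \<rho>) < card S" by (auto simp: not_le)
    have "card S \<le> card {1..N}" using S by (intro card_mono) auto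
    moreover have "(\<Union>\<rho>\<in>S. c ` F \<rho>) \<subseteq> {1..N}"
    proof -
      have "(\<Union>\<rho>\<in>S. F \<rho>) \<subseteq> E" using F S by blast
      then show ?thesis using c_space unfolding space_color_space by fast
    qed
    moreover have "card (\<Union>\<rho>\<in>S. c ` F \<rho>) \<le> card S - 1" using S(2) by linarith
    moreover have "card S - 1 \<le> card {1..N}" using \<open>card S \<le> card {1..N}\<close> by linarith
    \<comment> \<open>\<open>T\<close> is padded to exactly \<open>card S - 1\<close> colors, so
      that its probability depends on the size of \<open>S\<close> and the degrees only.\<close>
    ultimately obtain T where T: "(\<Union>\<rho>\<in>S. c ` F \<rho>) \<subseteq> T" "T \<subseteq> {1..N}" "card T = card S - 1"
      by (metis exists_subset_between finite_atLeastAtMost)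
    have "1 \<le> card S" "card S \<le> N" using S(2) \<open>card S \<le> card {1..N}\<close> by auto
    then have "(card S, S, T) \<in> J" using S(1) T(2,3) by (simp add: J_def)
    moreover have "c \<in> B S T" using c_space T(1) unfolding B_def by blast
    ultimately show "c \<in> (\<Union>(s, S, T)\<in>J. B S T)" by blast
  qed
  then have "prob {c \<in> space ?M. \<not> (\<exists>f. (\<forall>\<rho>\<in>{1..N}. f \<rho> \<in> c ` F \<rho>) \<and> inj_on f {1..N})}
      \<le> prob (\<Union>(s, S, T)\<in>J. B S T)"
    by (rule finite_measure_mono[OF _ ev]) (auto simp: B_def)
  also have "\<dots> \<le> (\<Sum>x\<in>J. prob (case x of (s, S, T) \<Rightarrow> B S T))"
  proof (rule finite_measure_subadditive_finite[OF finJ], safe)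
    fix s S T show "B S T \<in> events" by (rule ev) (auto simp: B_def)
  qed
  also have "\<dots> = (\<Sum>(s, S, T)\<in>J. (real (s - 1) / real N) ^ (\<Sum>\<rho>\<in>S. pick_degree N \<rho>))"
  proof (rule sum.cong[OF refl], safe)
    fix s S T assume J: "(s, S, T) \<in> J"
    then have S: "S \<subseteq> {1..N}" and T: "T \<subseteq> {1..N}" "card T = s - 1" by (auto simp: J_def)
    have "card (\<Union> (F ` S)) = (\<Sum>\<rho>\<in>S. card (F \<rho>))"
    proof (rule card_UN_disjoint)
      show "finite S" using S finite_subset by blast
      show "\<forall>i\<in>S. finite (F i)" using F S E finite_subset by blast
      show "\<forall>i\<in>S. \<forall>j\<in>S. i \<noteq> j \<longrightarrow> F i \<inter> F j = {}"
        using disj S unfolding disjoint_family_on_def by blast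
    qed
    also have "\<dots> = (\<Sum>\<rho>\<in>S. pick_degree N \<rho>)" using F S by (intro sum.cong) auto
    finally have card: "card (\<Union> (F ` S)) = (\<Sum>\<rho>\<in>S. pick_degree N \<rho>)" .
    have "\<Union> (F ` S) \<subseteq> E" using F S by blast
    from prob_colors_in[OF E this T(1) N]
    show "prob (B S T) = (real (s - 1) / real N) ^ (\<Sum>\<rho>\<in>S. pick_degree N \<rho>)"
      unfolding B_def card T(2) .
  qed
  also have "\<dots> = (\<Sum>s=1..N. \<Sum>(S, T)\<in>{S. S \<subseteq> {1..N} \<and> card S = s} \<times> {T. T \<subseteq> {1..N} \<and> card T = s - 1}.
      (real (s - 1) / real N) ^ (\<Sum>\<rho>\<in>S. pick_degree N \<rho>))"
    unfolding J_def by (subst sum.Sigma) auto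
  also have "\<dots> = (\<Sum>s=1..N. hall_term N s)"
    unfolding hall_term_def sum.cartesian_product[symmetric] by (simp add: n_subsets)
  finally show ?thesis .
qed

text \<open>Bernoulli's inequality with half of the quadratic term; the other half absorbs the
  higher terms while \<open>m * y \<le> 1\<close>. The linear bound would be useless here, since the
  quadratic term is the order of the expected number of repetitions.\<close>

lemma one_minus_power_ge:
  fixes y :: real
  assumes y: "0 \<le> y" and m: "real m * y \<le> 1"
  shows "1 - real m * y + real m * (real m - 1) * y\<^sup>2 / 4 \<le> (1 - y) ^ m"
  using m
proof (induction m)
  case (Suc m)
  have my: "real m * y \<le> 1" "y \<le> 1"
  proof -
    show "real m * y \<le> 1" using Suc.prems y by (simp add: algebra_simps)
    have "0 \<le> real m * y" using y by simp
    moreover have "y + real m * y \<le> 1" using Suc.prems by (simp add: algebra_simps)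
    ultimately show "y \<le> 1" by linarith
  qed
  have "(real m - 1) * y \<le> 1" using my y by (simp add: algebra_simps)
  then have nonneg: "0 \<le> real m * y\<^sup>2 / 4 * (2 - (real m - 1) * y)" by simp
  have "(1 - a * y + a * (a - 1) * y\<^sup>2 / 4) * (1 - y) - (1 - (a + 1) * y + (a + 1) * (a + 1 - 1) * y\<^sup>2 / 4)
      = a * y\<^sup>2 / 4 * (2 - (a - 1) * y)" for a
    by (simp add: field_simps power2_eq_square)
  from this[of "real m"] nonneg
  have "1 - real (Suc m) * y + real (Suc m) * (real (Suc m) - 1) * y\<^sup>2 / 4
     \<le> (1 - real m * y + real m * (real m - 1) * y\<^sup>2 / 4) * (1 - y)"
    by (simp add: add.commute)
  also have "\<dots> \<le> (1 - y) ^ m * (1 - y)"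
    using Suc.IH my by (intro mult_right_mono) auto
  finally show ?case by (simp add: mult.commute)
qed simp

text \<open>Repetitions are counted through the colors that do not occur: their number exceeds
  \<open>N - m\<close> by exactly the number of repetitions. Its mean exceeds \<open>N - m\<close>
  by at least \<open>2 * t\<close>, and half of that excess is given away. Missing two colors is
  negatively correlated, as \<open>1 - 2 / N \<le> (1 - 1 / N)\<^sup>2\<close>, so \<delta> is
  0.\<close>

lemma prob_few_repeated_colors:
  assumes E: "finite E" "K \<subseteq> E" and N: "2 \<le> N" and m: "card K = m" "2 \<le> m" "m \<le> N"
  shows "measure (color_space E N) {c \<in> space (color_space E N).
      real m - real (card (c ` K)) \<le> real m * (real m - 1) / (8 * real N)}
      \<le> 64 * real N ^ 3 / (real m * (real m - 1))\<^sup>2"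
proof -
  let ?M = "color_space E N"
  interpret prob_space ?M using N by (intro prob_space_color_space) simp
  have ev: "A \<in> events" if "A \<subseteq> space ?M" for A
    using that E by (intro sets_color_space) (auto simp: space_color_space)
  define A where "A i = {c \<in> space ?M. c ` K \<subseteq> {1..N} - {i}}" for i
  have A: "A i \<in> events" for i unfolding A_def by (intro ev) auto
  have N0: "0 < real N" using N by simp
  define p where "p = (1 - 1 / real N) ^ m"
  define t where "t = real m * (real m - 1) / (8 * real N)"
  have t: "0 < t" using m N0 by (simp add: t_def)
  have p: "0 \<le> p" "p \<le> 1" using N by (auto simp: p_def intro!: power_le_one)
  have PA: "prob (A i) = p" if "i \<in> {1..N}" for i
  proof -
    have "card ({1..N} - {i}) = N - 1" using that by simp
    then have "prob (A i) = (real (N - 1) / real N) ^ m"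
      unfolding A_def using prob_colors_in[of E K "{1..N} - {i}" N] E N m by simp
    also have "real (N - 1) / real N = 1 - 1 / real N" using N by (simp add: of_nat_diff field_simps)
    finally show ?thesis by (simp add: p_def)
  qed
  have PAA: "prob (A i \<inter> A j) \<le> p * p" if "i \<in> {1..N}" "j \<in> {1..N} - {i}" for i j
  proof -
    have "card ({1..N} - {i, j}) = N - 2" using that by (subst card_Diff_subset) auto
    moreover have "A i \<inter> A j = {c \<in> space ?M. c ` K \<subseteq> {1..N} - {i, j}}" by (auto simp: A_def)
    ultimately have "prob (A i \<inter> A j) = (real (N - 2) / real N) ^ m"
      using prob_colors_in[of E K "{1..N} - {i, j}" N] E N m by simp
    also have "real (N - 2) / real N = 1 - 2 / real N" using N by (simp add: of_nat_diff field_simps)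
    also have "(1 - 2 / real N) ^ m \<le> ((1 - 1 / real N) * (1 - 1 / real N)) ^ m"
      using N by (intro power_mono) (auto simp: field_simps)
    finally show ?thesis by (simp add: p_def power_mult_distrib)
  qed
  define \<mu> where "\<mu> = real N * p"
  have "prob {c \<in> space ?M. real (card {i\<in>{1..N}. c \<in> A i}) \<le> \<mu> - t} \<le> (\<mu> + 0 * \<mu>\<^sup>2) / t\<^sup>2"
  proof (rule count_lower_tail)
    show "\<mu> = (\<Sum>i\<in>{1..N}. prob (A i))" using PA by (simp add: \<mu>_def)
    have "(\<Sum>i\<in>{1..N}. \<Sum>j\<in>{1..N} - {i}. prob (A i \<inter> A j)) \<le> (\<Sum>i\<in>{1..N}. \<Sum>j\<in>{1..N} - {i}. p * p)"
      by (intro sum_mono PAA)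
    also have "\<dots> \<le> (\<Sum>i\<in>{1..N}. \<Sum>j\<in>{1..N}. p * p)"
      using p by (intro sum_mono sum_mono2) auto
    finally show "(\<Sum>i\<in>{1..N}. \<Sum>j\<in>{1..N} - {i}. prob (A i \<inter> A j)) \<le> (1 + 0) * \<mu>\<^sup>2"
      by (simp add: \<mu>_def power2_eq_square mult_ac)
  qed (use A t in auto)
  also have "\<dots> \<le> real N / t\<^sup>2" using p N0 by (intro divide_right_mono) (auto simp: \<mu>_def)
  also have "\<dots> = 64 * real N ^ 3 / (real m * (real m - 1))\<^sup>2"
  proof -
    have "real N / (a / (8 * real N))\<^sup>2 = 64 * real N ^ 3 / a\<^sup>2" for a
      by (simp add: power2_eq_square power3_eq_cube)
    then show ?thesis by (simp only: t_def)
  qed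
  finally have tail: "prob {c \<in> space ?M. real (card {i\<in>{1..N}. c \<in> A i}) \<le> \<mu> - t}
    \<le> 64 * real N ^ 3 / (real m * (real m - 1))\<^sup>2" .
  have "real N - real m + 2 * t \<le> \<mu>"
  proof -
    have "1 - real m * (1 / real N) + real m * (real m - 1) * (1 / real N)\<^sup>2 / 4 \<le> p"
      unfolding p_def using N0 m by (intro one_minus_power_ge) auto
    then have "real N * (1 - real m * (1 / real N) + real m * (real m - 1) * (1 / real N)\<^sup>2 / 4) \<le> \<mu>"
      unfolding \<mu>_def using N0 by (intro mult_left_mono) auto
    moreover have "real N * (1 - real m * (1 / real N) + real m * (real m - 1) * (1 / real N)\<^sup>2 / 4)
      = real N - real m + 2 * t"
      using N0 unfolding t_def by (simp add: power2_eq_square field_simps)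
    ultimately show ?thesis by simp
  qed
  moreover have "real (card {i\<in>{1..N}. c \<in> A i}) = real N - real (card (c ` K))"
    if c: "c \<in> space ?M" for c
  proof -
    have sub: "c ` K \<subseteq> {1..N}" using c E by (auto simp: space_color_space)
    then have "{i\<in>{1..N}. c \<in> A i} = {1..N} - c ` K" using c by (auto simp: A_def)
    then show ?thesis using sub card_mono[OF _ sub]
      by (simp add: card_Diff_subset finite_subset[OF sub] of_nat_diff)
  qed
  ultimately have sub: "{c \<in> space ?M. real m - real (card (c ` K)) \<le> t} \<subseteq>
      {c \<in> space ?M. real (card {i\<in>{1..N}. c \<in> A i}) \<le> \<mu> - t}" by auto
  have "{c \<in> space ?M. real (card {i\<in>{1..N}. c \<in> A i}) \<le> \<mu> - t} \<in> events"
    by (rule ev) blast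
  from order_trans[OF finite_measure_mono[OF sub this] tail] show ?thesis by (simp only: t_def)
qed

section \<open>Short rainbow trees\<close>

text \<open>The sum telescopes: by the arithmetic-geometric mean inequality each term is at most
  twice the increment of the square root.\<close>

lemma sum_inverse_sqrt_le: "(\<Sum>i=1..N. 1 / sqrt (real i)) \<le> 2 * sqrt (real N)"
proof (induction N)
  case (Suc N)
  have "sqrt (real N) * sqrt (real (Suc N)) \<le> (real N + real (Suc N)) / 2"
    using arith_geo_mean_sqrt[of "real N" "real (Suc N)"] by (simp add: real_sqrt_mult)
  then have "2 * sqrt (real N) * sqrt (real (Suc N)) + 1 \<le> 2 * real (Suc N)" by simp
  also have "\<dots> = 2 * sqrt (real (Suc N)) * sqrt (real (Suc N))"
    by (simp only: mult.assoc real_sqrt_mult_self abs_of_nat)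
  finally have "2 * sqrt (real N) + 1 / sqrt (real (Suc N)) \<le> 2 * sqrt (real (Suc N))"
    by (simp add: field_simps)
  then show ?case using Suc by simp
qed simp

text \<open>With \<open>m = N + 1 - \<rho>\<close>, partial fractions split
  \<open>N / (\<rho> * m)\<close> into at most \<open>1 / \<rho> + 1 / m\<close>. The square root is
  subadditive, and reversing the order of summation makes the two sums equal.\<close>

lemma sum_pick_radius_le:
  "(\<Sum>\<rho>=1..N. 2 * sqrt 2 * sqrt (real (pick_degree N \<rho>) / real (N + 1 - \<rho>))) \<le> 8 * sqrt 120 * sqrt (real N)"
proof -
  have le: "sqrt (real (pick_degree N \<rho>) / real (N + 1 - \<rho>)) \<le> sqrt 60 * (1 / sqrt (real \<rho>) + 1 / sqrt (real (N + 1 - \<rho>)))"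
    if \<rho>: "\<rho> \<in> {1..N}" for \<rho>
  proof -
    define m where "m = N + 1 - \<rho>"
    have pos: "0 < real \<rho>" "0 < real m" "real \<rho> + real m = real N + 1" using \<rho> by (auto simp: m_def)
    have "real (pick_degree N \<rho>) / real m \<le> 60 * real N / real \<rho> / real m"
      using pick_degree_bounds(3)[OF \<rho>] by (intro divide_right_mono) auto
    also have "\<dots> = 60 * (real N / (real \<rho> + real m)) * (1 / real \<rho> + 1 / real m)"
    proof -
      have "60 * real N / a / b = 60 * (real N / (a + b)) * (1 / a + 1 / b)" if "0 < a" "0 < b" for a b :: real
      proof -
        have "1 / a + 1 / b = (a + b) / (a * b)" "a + b \<noteq> 0" using that by (auto simp: field_simps)
        then show ?thesis by simp
      qed
      then show ?thesis using pos by blast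
    qed
    also have "\<dots> \<le> 60 * 1 * (1 / real \<rho> + 1 / real m)"
      using pos by (intro mult_right_mono mult_left_mono) auto
    finally have "sqrt (real (pick_degree N \<rho>) / real m) \<le> sqrt (60 * (1 / real \<rho> + 1 / real m))"
      by (intro real_sqrt_le_mono) simp
    also have "\<dots> = sqrt 60 * sqrt (1 / real \<rho> + 1 / real m)" by (simp only: real_sqrt_mult)
    also have "\<dots> \<le> sqrt 60 * (sqrt (1 / real \<rho>) + sqrt (1 / real m))"
      by (intro mult_left_mono sqrt_add_le_add_sqrt) auto
    finally show ?thesis by (simp add: m_def real_sqrt_divide)
  qed
  have "(\<Sum>\<rho>=1..N. 2 * sqrt 2 * sqrt (real (pick_degree N \<rho>) / real (N + 1 - \<rho>))) \<le>
    (\<Sum>\<rho>=1..N. 2 * sqrt 2 * (sqrt 60 * (1 / sqrt (real \<rho>) + 1 / sqrt (real (N + 1 - \<rho>)))))"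
    by (intro sum_mono mult_left_mono le) auto
  also have "\<dots> = 2 * sqrt 2 * sqrt 60 *
      ((\<Sum>\<rho>=1..N. 1 / sqrt (real \<rho>)) + (\<Sum>\<rho>=1..N. 1 / sqrt (real (N + 1 - \<rho>))))"
    by (simp only: sum_distrib_left sum.distrib mult.assoc distrib_left)
  also have "(\<Sum>\<rho>=1..N. 1 / sqrt (real (N + 1 - \<rho>))) = (\<Sum>\<rho>=1..N. 1 / sqrt (real \<rho>))"
    by (rule sum.reindex_bij_witness[of _ "\<lambda>m. N + 1 - m" "\<lambda>m. N + 1 - m"]) auto
  also have "2 * sqrt 2 * sqrt 60 * ((\<Sum>\<rho>=1..N. 1 / sqrt (real \<rho>)) + (\<Sum>\<rho>=1..N. 1 / sqrt (real \<rho>)))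
    \<le> 2 * sqrt 2 * sqrt 60 * (2 * sqrt (real N) + 2 * sqrt (real N))"
    by (intro mult_left_mono add_mono sum_inverse_sqrt_le) auto
  also have "\<dots> = 8 * (sqrt 2 * sqrt 60) * sqrt (real N)" by simp
  also have "sqrt 2 * sqrt 60 = sqrt (120 :: real)" by (simp flip: real_sqrt_mult)
  finally show ?thesis .
qed

text \<open>The positions are fixed, so ranking and candidate sets are deterministic and only colors
  are random. Every candidate edge of rank \<rho> has length at most \<open>r \<rho>\<close>; hence
  any system of distinct representatives gives a tree of total length at most the sum of the
  radii.\<close>

lemma prob_no_short_rainbow_tree:
  fixes x :: "nat \<Rightarrow> point"
  assumes x: "\<And>i. i \<in> {1..N + 1} \<Longrightarrow> x i \<in> unit_square" and N: "0 < N"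
  shows "measure (color_space (complete_edges (N + 1)) N) {c \<in> space (color_space (complete_edges (N + 1)) N).
      \<not> (\<exists>T. spanning_tree (N + 1) T \<and> rainbow c T \<and> total_length x T \<le> 8 * sqrt 120 * sqrt (real N))}
    \<le> (\<Sum>s=1..N. hall_term N s)"
proof -
  let ?E = "complete_edges (N + 1)"
  let ?M = "color_space ?E N"
  interpret prob_space ?M using N by (rule prob_space_color_space)
  define r where "r \<rho> = 2 * sqrt 2 * sqrt (real (pick_degree N \<rho>) / real (N + 1 - \<rho>))" for \<rho>
  obtain v where v: "bij_betw v {1..N} {2..N + 1}"
    and near: "\<And>\<rho>. \<rho> \<in> {1..N} \<Longrightarrow> pick_degree N \<rho> \<le> card {j\<in>{1..<v \<rho>}. dist (x (v \<rho>)) (x j) \<le> r \<rho>}"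
  proof (rule greedy_ranking[of N x "pick_degree N"])
    fix i assume "i \<in> {1..N + 1}"
    then show "x i \<in> unit_square" by (rule x)
  next
    fix \<rho> assume "\<rho> \<in> {1..N}"
    then show "0 < pick_degree N \<rho> \<and> pick_degree N \<rho> \<le> N + 1 - \<rho>"
      using pick_degree_bounds by blast
  qed (simp only: r_def)
  have "\<exists>K. K \<subseteq> {j\<in>{1..<v \<rho>}. dist (x (v \<rho>)) (x j) \<le> r \<rho>} \<and> card K = pick_degree N \<rho>"
    if "\<rho> \<in> {1..N}" for \<rho>
    using near[OF that] by (rule obtain_subset_with_card_n) blast
  then have "\<exists>K. \<forall>\<rho>\<in>{1..N}. K \<rho> \<subseteq> {j\<in>{1..<v \<rho>}. dist (x (v \<rho>)) (x j) \<le> r \<rho>} \<and>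
      card (K \<rho>) = pick_degree N \<rho>"
    by (intro bchoice) blast
  then obtain K where K: "\<And>\<rho>. \<rho> \<in> {1..N} \<Longrightarrow>
      K \<rho> \<subseteq> {j\<in>{1..<v \<rho>}. dist (x (v \<rho>)) (x j) \<le> r \<rho>} \<and> card (K \<rho>) = pick_degree N \<rho>"
    by blast
  have v_in: "v \<rho> \<in> {2..N + 1}" if "\<rho> \<in> {1..N}" for \<rho> using bij_betwE[OF v] that by blast
  define F where "F \<rho> = (\<lambda>j. {v \<rho>, j}) ` K \<rho>" for \<rho>
  have F: "F \<rho> \<subseteq> ?E \<and> card (F \<rho>) = pick_degree N \<rho>" if \<rho>: "\<rho> \<in> {1..N}" for \<rho>
  proof
    have "{v \<rho>, j} \<in> ?E" if "j \<in> K \<rho>" for j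
    proof -
      have "j \<in> {1..<v \<rho>}" using conjunct1[OF K[OF \<rho>]] that by blast
      then show ?thesis using v_in[OF \<rho>] by (simp add: complete_edges_def)
    qed
    then show "F \<rho> \<subseteq> ?E" unfolding F_def by blast
    have "inj_on (\<lambda>j. {v \<rho>, j}) (K \<rho>)" by (rule inj_onI) (auto simp: doubleton_eq_iff)
    from card_image[OF this] show "card (F \<rho>) = pick_degree N \<rho>" using conjunct2[OF K[OF \<rho>]] by (simp only: F_def)
  qed
  have disj: "disjoint_family_on F {1..N}"
    unfolding disjoint_family_on_def
  proof (intro ballI impI)
    fix \<rho> \<sigma> assume \<rho>\<sigma>: "\<rho> \<in> {1..N}" "\<sigma> \<in> {1..N}" "\<rho> \<noteq> \<sigma>"
    then have ne: "v \<rho> \<noteq> v \<sigma>" using inj_on_eq_iff[OF bij_betw_imp_inj_on[OF v]] by blast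
    \<comment> \<open>The larger endpoint of a candidate edge is the vertex that proposes
      it.\<close>
    have "{v \<rho>, j} \<noteq> {v \<sigma>, k}" if "j \<in> K \<rho>" "k \<in> K \<sigma>" for j k
    proof -
      have "j < v \<rho>" "k < v \<sigma>"
        using subsetD[OF conjunct1[OF K[OF \<rho>\<sigma>(1)]] that(1)] subsetD[OF conjunct1[OF K[OF \<rho>\<sigma>(2)]] that(2)]
        by simp_all
      then show ?thesis using ne by (auto simp: doubleton_eq_iff)
    qed
    then show "F \<rho> \<inter> F \<sigma> = {}" unfolding F_def by blast
  qed
  have tree: "\<exists>T. spanning_tree (N + 1) T \<and> rainbow c T \<and> total_length x T \<le> 8 * sqrt 120 * sqrt (real N)"
    if f: "\<forall>\<rho>\<in>{1..N}. f \<rho> \<in> c ` F \<rho>" "inj_on f {1..N}" for c f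
  proof -
    have "\<exists>j. j \<in> K \<rho> \<and> f \<rho> = c {v \<rho>, j}" if "\<rho> \<in> {1..N}" for \<rho> using f(1) that unfolding F_def by blast
    then have "\<exists>j. \<forall>\<rho>\<in>{1..N}. j \<rho> \<in> K \<rho> \<and> f \<rho> = c {v \<rho>, j \<rho>}" by (intro bchoice) blast
    then obtain j where j: "\<And>\<rho>. \<rho> \<in> {1..N} \<Longrightarrow> j \<rho> \<in> K \<rho> \<and> f \<rho> = c {v \<rho>, j \<rho>}" by blast
    have vimg: "v ` {1..N} = {2..N + 1}" and vinj: "inj_on v {1..N}"
      using v unfolding bij_betw_def by blast+
    \<comment> \<open>\<open>j\<close> picks for each rank a candidate edge of the color
      \<open>f \<rho>\<close>; \<open>p\<close> carries this choice over from ranks to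
      vertices.\<close>
    define p where "p i = j (inv_into {1..N} v i)" for i
    define e where "e \<rho> = {v \<rho>, j \<rho>}" for \<rho>
    define T where "T = e ` {1..N}"
    have "(\<lambda>i. {i, p i}) ` {2..N + 1} = (\<lambda>i. {i, p i}) ` (v ` {1..N})" by (simp only: vimg)
    also have "\<dots> = T"
      unfolding T_def image_image
      by (intro image_cong refl) (simp only: p_def e_def inv_into_f_f[OF vinj])
    finally have T_eq: "T = (\<lambda>i. {i, p i}) ` {2..N + 1}" ..
    have "spanning_tree (N + 1) T"
      unfolding T_eq
    proof (rule parent_tree)
      fix i assume "i \<in> {2..N + 1}"
      then obtain \<rho> where \<rho>: "\<rho> \<in> {1..N}" "i = v \<rho>" unfolding vimg[symmetric] by blast
      then have "p i = j \<rho>" by (simp only: p_def inv_into_f_f[OF vinj])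
      moreover have "j \<rho> \<in> {1..<v \<rho>}"
        using subsetD[OF conjunct1[OF K[OF \<rho>(1)]] conjunct1[OF j[OF \<rho>(1)]]] by simp
      ultimately show "p i \<in> {1..<i}" unfolding \<rho>(2) by (simp only:)
    qed
    moreover have fe: "c (e \<rho>) = f \<rho>" if "\<rho> \<in> {1..N}" for \<rho> using j[OF that] by (simp add: e_def)
    have "rainbow c T"
      unfolding rainbow_def T_def
    proof (rule inj_onI)
      fix a b assume "a \<in> e ` {1..N}" "b \<in> e ` {1..N}" "c a = c b"
      then obtain \<rho> \<sigma> where "\<rho> \<in> {1..N}" "\<sigma> \<in> {1..N}" "a = e \<rho>" "b = e \<sigma>" "f \<rho> = f \<sigma>"
        using fe by (elim imageE) simp
      then show "a = b" using inj_onD[OF f(2)] by blast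
    qed
    moreover have "total_length x T \<le> 8 * sqrt 120 * sqrt (real N)"
    proof -
      have "total_length x T \<le> (\<Sum>\<rho>\<in>{1..N}. edge_length x (e \<rho>))"
        unfolding total_length_def T_def
        using sum_image_le[of "{1..N}" "edge_length x" e] by (simp add: edge_length_def comp_def)
      also have "\<dots> \<le> (\<Sum>\<rho>\<in>{1..N}. r \<rho>)"
      proof (rule sum_mono)
        fix \<rho> assume \<rho>: "\<rho> \<in> {1..N}"
        then show "edge_length x (e \<rho>) \<le> r \<rho>"
          using subsetD[OF conjunct1[OF K[OF \<rho>]] conjunct1[OF j[OF \<rho>]]]
          unfolding e_def edge_length_doubleton by simp
      qed
      also have "\<dots> \<le> 8 * sqrt 120 * sqrt (real N)" using sum_pick_radius_le[of N] by (simp only: r_def)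
      finally show ?thesis .
    qed
    ultimately show ?thesis by blast
  qed
  have "prob {c \<in> space ?M. \<not> (\<exists>T. spanning_tree (N + 1) T \<and> rainbow c T \<and>
        total_length x T \<le> 8 * sqrt 120 * sqrt (real N))}
    \<le> prob {c \<in> space ?M. \<not> (\<exists>f. (\<forall>\<rho>\<in>{1..N}. f \<rho> \<in> c ` F \<rho>) \<and> inj_on f {1..N})}"
  proof (rule finite_measure_mono)
    show "{c \<in> space ?M. \<not> (\<exists>f. (\<forall>\<rho>\<in>{1..N}. f \<rho> \<in> c ` F \<rho>) \<and> inj_on f {1..N})} \<in> events"
      by (rule sets_color_space[OF finite_complete_edges]) (simp only: space_color_space, blast)
  next
    show "{c \<in> space ?M. \<not> (\<exists>T. spanning_tree (N + 1) T \<and> rainbow c T \<and>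
        total_length x T \<le> 8 * sqrt 120 * sqrt (real N))}
      \<subseteq> {c \<in> space ?M. \<not> (\<exists>f. (\<forall>\<rho>\<in>{1..N}. f \<rho> \<in> c ` F \<rho>) \<and> inj_on f {1..N})}"
      using tree by blast
  qed
  also have "\<dots> \<le> (\<Sum>s=1..N. hall_term N s)"
    using prob_no_distinct_colors[OF finite_complete_edges N F disj] .
  finally show ?thesis .
qed

section \<open>Isolated pairs of random points\<close>

definition uniform_point :: "point measure" where
  "uniform_point = uniform_measure lborel ({0..1} \<times> {0..1})"

definition position_space :: "nat \<Rightarrow> (nat \<Rightarrow> point) measure" where
  "position_space n = (\<Pi>\<^sub>M i\<in>{1..n}. uniform_point)"

section \<open>The uniform distribution on the square\<close>

lemma mem_rectangle:
  "p \<in> box (a, c) (b, d) \<longleftrightarrow> a < fst p \<and> fst p < b \<and> c < snd p \<and> snd p < (d :: real)"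
  "p \<in> cbox (a, c) (b, d) \<longleftrightarrow> a \<le> fst p \<and> fst p \<le> b \<and> c \<le> snd p \<and> snd p \<le> (d :: real)"
  for a b :: real
proof -
  have Basis: "(Basis :: point set) = {(1, 0), (0, 1)}" by (auto simp: Basis_prod_def)
  show "p \<in> box (a, c) (b, d) \<longleftrightarrow> a < fst p \<and> fst p < b \<and> c < snd p \<and> snd p < d"
    "p \<in> cbox (a, c) (b, d) \<longleftrightarrow> a \<le> fst p \<and> fst p \<le> b \<and> c \<le> snd p \<and> snd p \<le> d"
    unfolding mem_box Basis by (cases p; auto)+
qed

lemma emeasure_lborel_rectangle:
  assumes "a \<le> b" "c \<le> d"
  shows "emeasure lborel (box (a, c) (b, d) :: point set) = ennreal ((b - a) * (d - c))"
    and "emeasure lborel (cbox (a, c) (b, d) :: point set) = ennreal ((b - a) * (d - c))"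
proof -
  have Basis: "(Basis :: point set) = {(1, 0), (0, 1)}" by (auto simp: Basis_prod_def)
  show "emeasure lborel (box (a, c) (b, d) :: point set) = ennreal ((b - a) * (d - c))"
    and "emeasure lborel (cbox (a, c) (b, d) :: point set) = ennreal ((b - a) * (d - c))"
    using assms unfolding emeasure_lborel_box_eq emeasure_lborel_cbox_eq Basis by simp_all
qed

lemma unit_square_cbox: "unit_square = cbox (0, 0) (1, 1)"
  by (auto simp: unit_square_def mem_rectangle)

lemma sets_uniform_point [simp, measurable_cong]: "sets uniform_point = sets borel"
  by (simp add: uniform_point_def)

lemma space_uniform_point [simp]: "space uniform_point = UNIV"
  by (simp add: uniform_point_def)

lemma uniform_point_eq: "uniform_point = uniform_measure lborel unit_square"
  by (simp add: uniform_point_def unit_square_def)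

lemma emeasure_unit_square: "emeasure lborel unit_square = 1"
  using emeasure_lborel_rectangle(2)[of 0 1 0 1] by (simp add: unit_square_cbox)

lemma prob_space_uniform_point: "prob_space uniform_point"
  unfolding uniform_point_eq
  by (rule prob_space_uniform_measure) (simp_all add: emeasure_unit_square)

lemma emeasure_uniform_point:
  assumes "A \<in> sets borel"
  shows "emeasure uniform_point A = emeasure lborel (unit_square \<inter> A)"
  using assms unfolding uniform_point_eq
  by (subst emeasure_uniform_measure) (auto simp: emeasure_unit_square divide_ennreal_def, simp add: unit_square_cbox)

lemma measure_uniform_point_rectangle:
  assumes "0 \<le> a" "a \<le> b" "b \<le> 1" "0 \<le> c" "c \<le> d" "d \<le> 1"
  shows "measure uniform_point (box (a, c) (b, d)) = (b - a) * (d - c)"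
proof -
  have "box (a, c) (b, d) \<subseteq> unit_square"
    using assms by (auto simp: unit_square_def mem_rectangle)
  then have "unit_square \<inter> box (a, c) (b, d) = box (a, c) (b, d)" by auto
  then have "emeasure uniform_point (box (a, c) (b, d)) = ennreal ((b - a) * (d - c))"
    using assms emeasure_lborel_rectangle(1)[of a b c d] by (simp add: emeasure_uniform_point)
  then show ?thesis using assms by (simp add: measure_def)
qed

lemma measure_uniform_point_square: "measure uniform_point unit_square = 1"
  using emeasure_uniform_point[of unit_square] emeasure_unit_square
  by (simp add: measure_def unit_square_cbox)

lemma prob_space_position_space: "prob_space (position_space n)"
  unfolding position_space_def by (intro prob_space_PiM prob_space_uniform_point)

lemma box_position_space:
  assumes "\<And>i. i \<in> {1..n} \<Longrightarrow> A i \<in> sets borel"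
  shows "Pi\<^sub>E {1..n} A \<in> sets (position_space n)"
    and "measure (position_space n) (Pi\<^sub>E {1..n} A) = (\<Prod>i\<in>{1..n}. measure uniform_point (A i))"
proof -
  show "Pi\<^sub>E {1..n} A \<in> sets (position_space n)"
    unfolding position_space_def using assms by (intro sets_PiM_I_finite) auto
  show "measure (position_space n) (Pi\<^sub>E {1..n} A) = (\<Prod>i\<in>{1..n}. measure uniform_point (A i))"
    unfolding position_space_def using assms
    by (intro measure_PiM_box prob_space_uniform_point) auto
qed

text \<open>Open boxes, so that distinct cells are disjoint; points on grid lines lie in no
  cell.\<close>

definition grid_cell :: "nat \<Rightarrow> nat \<times> nat \<Rightarrow> point set" where
  "grid_cell k c = box (real (fst c) / k, real (snd c) / k) ((real (fst c) + 1) / k, (real (snd c) + 1) / k)"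

text \<open>The middle fifth in each direction. In units of \<open>1 / k\<close>, two points of a
  core are within \<open>sqrt 2 / 5 < 3 / 10\<close>, while everything outside the cell is at least
  \<open>2 / 5\<close> away. The difference of \<open>1 / 10\<close> is what an exchange
  saves.\<close>

definition cell_core :: "nat \<Rightarrow> nat \<times> nat \<Rightarrow> point set" where
  "cell_core k c = box ((real (fst c) + 2 / 5) / k, (real (snd c) + 2 / 5) / k)
     ((real (fst c) + 3 / 5) / k, (real (snd c) + 3 / 5) / k)"

lemma mem_grid_cell:
  assumes "0 < k"
  shows "p \<in> grid_cell k c \<longleftrightarrow> real (fst c) < k * fst p \<and> k * fst p < real (fst c) + 1 \<and>
     real (snd c) < k * snd p \<and> k * snd p < real (snd c) + 1"
  using assms unfolding grid_cell_def by (auto simp: mem_rectangle field_simps)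

lemma mem_cell_core:
  assumes "0 < k"
  shows "p \<in> cell_core k c \<longleftrightarrow> real (fst c) + 2 / 5 < k * fst p \<and> k * fst p < real (fst c) + 3 / 5 \<and>
     real (snd c) + 2 / 5 < k * snd p \<and> k * snd p < real (snd c) + 3 / 5"
  using assms unfolding cell_core_def by (auto simp: mem_rectangle field_simps)

lemma cell_core_subset: "0 < k \<Longrightarrow> cell_core k c \<subseteq> grid_cell k c"
  by (auto simp: mem_grid_cell mem_cell_core)

lemma grid_cell_disjoint:
  assumes "0 < k" "p \<in> grid_cell k c" "p \<in> grid_cell k c'"
  shows "c = c'"
proof -
  have "real (fst c) < real (fst c') + 1" "real (fst c') < real (fst c) + 1"
    "real (snd c) < real (snd c') + 1" "real (snd c') < real (snd c) + 1"
    using assms by (auto simp: mem_grid_cell)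
  then show ?thesis by (intro prod_eqI) linarith+
qed

lemma dist_cell_core_le:
  assumes k: "0 < k" and p: "p \<in> cell_core k c" "q \<in> cell_core k c"
  shows "dist p q \<le> 3 / (10 * real k)"
proof -
  have "\<bar>real k * fst p - real k * fst q\<bar> \<le> 1 / 5" "\<bar>real k * snd p - real k * snd q\<bar> \<le> 1 / 5"
    using p k unfolding mem_cell_core[OF k] by linarith+
  then have "real k * \<bar>fst p - fst q\<bar> \<le> 1 / 5" "real k * \<bar>snd p - snd q\<bar> \<le> 1 / 5"
    by (simp_all add: abs_mult flip: right_diff_distrib)
  then have "\<bar>fst p - fst q\<bar> \<le> 1 / (5 * real k)" "\<bar>snd p - snd q\<bar> \<le> 1 / (5 * real k)"
    using k by (simp_all add: field_simps)
  then have "(dist (fst p) (fst q))\<^sup>2 \<le> (1 / (5 * real k))\<^sup>2" "(dist (snd p) (snd q))\<^sup>2 \<le> (1 / (5 * real k))\<^sup>2"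
    by (metis abs_ge_zero dist_real_def power_mono)+
  moreover have "(1 / (5 * real k))\<^sup>2 + (1 / (5 * real k))\<^sup>2 \<le> (3 / (10 * real k))\<^sup>2"
    using k by (simp add: power2_eq_square field_simps)
  ultimately have "(dist (fst p) (fst q))\<^sup>2 + (dist (snd p) (snd q))\<^sup>2 \<le> (3 / (10 * real k))\<^sup>2"
    by linarith
  then show ?thesis unfolding dist_prod_def by (intro real_le_lsqrt) auto
qed

lemma dist_cell_core_ge:
  assumes k: "0 < k" and p: "p \<in> cell_core k c" "q \<notin> grid_cell k c"
  shows "4 / (10 * real k) \<le> dist p q"
proof -
  have "2 / 5 \<le> \<bar>real k * fst p - real k * fst q\<bar> \<or> 2 / 5 \<le> \<bar>real k * snd p - real k * snd q\<bar>"
    using p unfolding mem_cell_core[OF k] mem_grid_cell[OF k] by linarith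
  then have "2 / 5 \<le> real k * \<bar>fst p - fst q\<bar> \<or> 2 / 5 \<le> real k * \<bar>snd p - snd q\<bar>"
    by (simp add: abs_mult flip: right_diff_distrib)
  then have "4 / (10 * real k) \<le> dist (fst p) (fst q) \<or> 4 / (10 * real k) \<le> dist (snd p) (snd q)"
    using k by (simp add: dist_real_def field_simps)
  then show ?thesis using dist_fst_le[of p q] dist_snd_le[of p q] by linarith
qed

lemma measure_cells:
  assumes k: "0 < k" and c: "c \<in> {..<k} \<times> {..<k}"
  shows "measure uniform_point (grid_cell k c) = 1 / (real k)\<^sup>2"
    and "measure uniform_point (cell_core k c) = 1 / (25 * (real k)\<^sup>2)"
proof -
  have k0: "0 < real k" using k by simp
  have c1: "real (fst c) + 1 \<le> real k" "real (snd c) + 1 \<le> real k" using c by auto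
  have rect: "measure uniform_point (box ((real (fst c) + s) / k, (real (snd c) + s) / k)
      ((real (fst c) + t) / k, (real (snd c) + t) / k)) = ((t - s) / k) * ((t - s) / k)"
    if "0 \<le> s" "s \<le> t" "t \<le> 1" for s t :: real
  proof -
    have ge: "0 \<le> (real a + s) / k" for a using that k0 by simp
    have mid: "(real a + s) / k \<le> (real a + t) / k" for a using that k0 by (simp add: divide_right_mono)
    have le: "(real a + t) / k \<le> 1" if "real a + 1 \<le> real k" for a using that \<open>t \<le> 1\<close> k0 by simp
    have diff: "(real a + t) / k - (real a + s) / k = (t - s) / k" for a
      by (simp add: diff_divide_distrib[symmetric])
    show ?thesis
      using measure_uniform_point_rectangle[OF ge mid le[OF c1(1)] ge mid le[OF c1(2)]] by (simp only: diff)
  qed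
  show "measure uniform_point (grid_cell k c) = 1 / (real k)\<^sup>2"
    using rect[of 0 1] unfolding grid_cell_def by (simp add: power2_eq_square)
  show "measure uniform_point (cell_core k c) = 1 / (25 * (real k)\<^sup>2)"
    using rect[of "2 / 5" "3 / 5"] unfolding cell_core_def by (simp add: power2_eq_square)
qed

definition pair_indices :: "nat \<Rightarrow> nat \<Rightarrow> ((nat \<times> nat) \<times> (nat \<times> nat)) set" where
  "pair_indices n k = ({..<k} \<times> {..<k}) \<times> (SIGMA i:{1..n}. {1..<i})"

text \<open>Written as a box, the event has a product as its probability. The points outside the
  pair must avoid the whole cell, not only its core; that is what isolates the pair.\<close>

definition lonely_pair :: "nat \<Rightarrow> nat \<Rightarrow> (nat \<times> nat) \<times> (nat \<times> nat) \<Rightarrow> (nat \<Rightarrow> point) set" where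
  "lonely_pair n k = (\<lambda>(c, i, j).
     Pi\<^sub>E {1..n} (\<lambda>l. if l \<in> {i, j} then cell_core k c else - grid_cell k c))"

lemma finite_pair_indices: "finite (pair_indices n k)"
  unfolding pair_indices_def by auto

lemma card_pair_indices: "real (card (pair_indices n k)) = (real k)\<^sup>2 * (real n * (real n - 1) / 2)"
proof -
  have "(\<Sum>i\<in>{1..n}. real (card {1..<i})) = real n * (real n - 1) / 2"
    by (induction n) (auto simp: field_simps)
  then have "real (card (SIGMA i:{1..n}. {1..<i})) = real n * (real n - 1) / 2"
    by (subst card_SigmaI) auto
  then show ?thesis
    unfolding pair_indices_def by (simp only: card_cartesian_product of_nat_mult card_lessThan power2_eq_square)
qed

lemma prob_lonely_pair:
  assumes k: "0 < k" and J: "(c, i, j) \<in> pair_indices n k"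
  shows "lonely_pair n k (c, i, j) \<in> sets (position_space n)"
    and "measure (position_space n) (lonely_pair n k (c, i, j)) =
      (1 / (25 * (real k)\<^sup>2))\<^sup>2 * (1 - 1 / (real k)\<^sup>2) ^ (n - 2)"
proof -
  interpret U: prob_space uniform_point by (rule prob_space_uniform_point)
  have c: "c \<in> {..<k} \<times> {..<k}" and ij: "i \<in> {1..n}" "j \<in> {1..n}" "i \<noteq> j"
    using J by (auto simp: pair_indices_def)
  define A where "A l = (if l \<in> {i, j} then cell_core k c else - grid_cell k c)" for l
  have A: "A l \<in> sets borel" for l by (auto simp: A_def cell_core_def grid_cell_def)
  have eq: "lonely_pair n k (c, i, j) = Pi\<^sub>E {1..n} A" unfolding lonely_pair_def prod.case A_def[abs_def] ..
  show "lonely_pair n k (c, i, j) \<in> sets (position_space n)"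
    unfolding eq using A by (rule box_position_space(1))
  have compl: "measure uniform_point (- grid_cell k c) = 1 - 1 / (real k)\<^sup>2"
    using U.prob_compl[of "grid_cell k c"] measure_cells(1)[OF k c] by (simp add: grid_cell_def Compl_eq_Diff_UNIV)
  have "measure (position_space n) (lonely_pair n k (c, i, j)) = (\<Prod>l\<in>{1..n}. measure uniform_point (A l))"
    unfolding eq using A by (rule box_position_space(2))
  also have "\<dots> = (\<Prod>l\<in>{i, j} \<union> ({1..n} - {i, j}). measure uniform_point (A l))"
    using ij by (intro prod.cong) auto
  also have "\<dots> = (\<Prod>l\<in>{i, j}. measure uniform_point (A l)) * (\<Prod>l\<in>{1..n} - {i, j}. measure uniform_point (A l))"
    by (rule prod.union_disjoint) auto
  also have "(\<Prod>l\<in>{i, j}. measure uniform_point (A l)) = (1 / (25 * (real k)\<^sup>2))\<^sup>2"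
    using ij measure_cells(2)[OF k c] by (simp add: A_def power2_eq_square)
  also have "(\<Prod>l\<in>{1..n} - {i, j}. measure uniform_point (A l)) = (\<Prod>l\<in>{1..n} - {i, j}. 1 - 1 / (real k)\<^sup>2)"
    by (intro prod.cong refl) (simp add: A_def compl)
  also have "\<dots> = (1 - 1 / (real k)\<^sup>2) ^ (n - 2)"
  proof -
    have "card {i, j} = 2" "{i, j} \<subseteq> {1..n}" using ij by auto
    then show ?thesis by (simp only: prod_constant) (simp add: card_Diff_subset)
  qed
  finally show "measure (position_space n) (lonely_pair n k (c, i, j)) =
      (1 / (25 * (real k)\<^sup>2))\<^sup>2 * (1 - 1 / (real k)\<^sup>2) ^ (n - 2)" .
qed

lemma lonely_pair_same_cell:
  assumes k: "0 < k" and l: "i \<in> {1..n}" "j \<in> {1..n}" "i' \<in> {1..n}" "j' \<in> {1..n}"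
    and x: "x \<in> lonely_pair n k (c, i, j)" "x \<in> lonely_pair n k (c, i', j')"
  shows "{i, j} = {i', j'}"
proof -
  have in1: "x l \<in> (if l \<in> {i, j} then cell_core k c else - grid_cell k c)"
    and in2: "x l \<in> (if l \<in> {i', j'} then cell_core k c else - grid_cell k c)" if "l \<in> {1..n}" for l
    using x that unfolding lonely_pair_def by (auto simp only: prod.case dest: PiE_mem)
  have "l \<in> {i, j} \<longleftrightarrow> l \<in> {i', j'}" if "l \<in> {1..n}" for l
    using in1[OF that] in2[OF that] cell_core_subset[OF k, of c] by (auto split: if_splits)
  then show ?thesis using l by blast
qed

text \<open>Compatible events concern different cells and disjoint pairs. Then four points lie in
  prescribed cores and the other \<open>n - 4\<close> avoid two cells, again a box.\<close>

lemma prob_two_lonely_pairs: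
  assumes k: "2 \<le> k" and n: "4 \<le> n" and J: "J \<in> pair_indices n k" "J' \<in> pair_indices n k" "J \<noteq> J'"
  shows "measure (position_space n) (lonely_pair n k J \<inter> lonely_pair n k J') \<le>
      (1 / (25 * (real k)\<^sup>2)) ^ 4 * (1 - 1 / (real k)\<^sup>2) ^ (2 * (n - 4))"
proof -
  interpret U: prob_space uniform_point by (rule prob_space_uniform_point)
  interpret P: prob_space "position_space n" by (rule prob_space_position_space)
  have k0: "0 < k" using k by simp
  obtain c i j c' i' j' where eq: "J = (c, i, j)" "J' = (c', i', j')" by (metis prod.exhaust)
  have c: "c \<in> {..<k} \<times> {..<k}" "c' \<in> {..<k} \<times> {..<k}"
    and ij: "i \<in> {1..n}" "j \<in> {1..n}" "j < i" "i' \<in> {1..n}" "j' \<in> {1..n}" "j' < i'"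
    using J by (auto simp: pair_indices_def eq)
  have p1: "1 / (real k)\<^sup>2 \<le> 1 / 4"
  proof -
    have "2\<^sup>2 \<le> (real k)\<^sup>2" using k by (intro power_mono) auto
    then show ?thesis using k0 by (simp add: field_simps)
  qed
  then have w0: "0 \<le> (1 / (25 * (real k)\<^sup>2)) ^ 4 * (1 - 1 / (real k)\<^sup>2) ^ (2 * (n - 4))" by simp
  show ?thesis
  \<comment> \<open>Different triples with a common cell or a common index exclude each other and
    fall under the empty case.\<close>
  proof (cases "lonely_pair n k J \<inter> lonely_pair n k J' = {}")
    case False
    then obtain x where x: "x \<in> lonely_pair n k (c, i, j)" "x \<in> lonely_pair n k (c', i', j')"
      unfolding eq by blast
    have "c \<noteq> c'"
    proof
      assume "c = c'"
      then have "{i, j} = {i', j'}" using lonely_pair_same_cell[OF k0] x ij by metis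
      then have "i = i' \<and> j = j'" using ij by (auto simp: doubleton_eq_iff)
      then show False using J(3) eq \<open>c = c'\<close> by simp
    qed
    then have cells: "grid_cell k c \<inter> grid_cell k c' = {}" using grid_cell_disjoint[OF k0] by blast
    have "l \<notin> {i', j'}" if "l \<in> {i, j}" for l
    proof
      assume l': "l \<in> {i', j'}"
      have "l \<in> {1..n}" using that ij by auto
      then have "x l \<in> cell_core k c" "x l \<in> cell_core k c'"
        using PiE_mem[OF x(1)[unfolded lonely_pair_def prod.case], of l]
          PiE_mem[OF x(2)[unfolded lonely_pair_def prod.case], of l] that l' by auto
      then show False using cells cell_core_subset[OF k0] by blast
    qed
    then have disj: "{i, j} \<inter> {i', j'} = {}" by blast
    define A where "A l = (if l \<in> {i, j} then cell_core k c else if l \<in> {i', j'} then cell_core k c'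
      else - (grid_cell k c \<union> grid_cell k c'))" for l
    have A: "A l \<in> sets borel" for l by (auto simp: A_def cell_core_def grid_cell_def)
    have compl: "measure uniform_point (- (grid_cell k c \<union> grid_cell k c')) = 1 - 2 / (real k)\<^sup>2"
    proof -
      have "measure uniform_point (grid_cell k c \<union> grid_cell k c') = 2 / (real k)\<^sup>2"
        using U.finite_measure_Union[OF _ _ cells] measure_cells(1)[OF k0 c(1)] measure_cells(1)[OF k0 c(2)]
        by (simp add: grid_cell_def)
      then show ?thesis
        using U.prob_compl[of "grid_cell k c \<union> grid_cell k c'"] by (simp add: grid_cell_def Compl_eq_Diff_UNIV)
    qed
    have "lonely_pair n k J \<inter> lonely_pair n k J' \<subseteq> Pi\<^sub>E {1..n} A"
    proof
      fix y assume y: "y \<in> lonely_pair n k J \<inter> lonely_pair n k J'"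
      then have 1: "y \<in> Pi\<^sub>E {1..n} (\<lambda>l. if l \<in> {i, j} then cell_core k c else - grid_cell k c)"
        and 2: "y \<in> Pi\<^sub>E {1..n} (\<lambda>l. if l \<in> {i', j'} then cell_core k c' else - grid_cell k c')"
        unfolding eq lonely_pair_def by simp_all
      show "y \<in> Pi\<^sub>E {1..n} A"
      proof (rule PiE_I)
        fix l assume "l \<in> {1..n}"
        from PiE_mem[OF 1 this] PiE_mem[OF 2 this] show "y l \<in> A l"
          unfolding A_def by (auto split: if_splits)
      qed (rule PiE_arb[OF 1])
    qed
    then have "measure (position_space n) (lonely_pair n k J \<inter> lonely_pair n k J') \<le>
        measure (position_space n) (Pi\<^sub>E {1..n} A)"
      using box_position_space(1)[of n A] A by (intro P.finite_measure_mono) auto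
    also have "\<dots> = (\<Prod>l\<in>{1..n}. measure uniform_point (A l))"
      using A by (rule box_position_space(2))
    also have "\<dots> = (\<Prod>l\<in>{i, j, i', j'} \<union> ({1..n} - {i, j, i', j'}). measure uniform_point (A l))"
      using ij by (intro prod.cong) auto
    also have "\<dots> = (\<Prod>l\<in>{i, j, i', j'}. measure uniform_point (A l)) *
        (\<Prod>l\<in>{1..n} - {i, j, i', j'}. measure uniform_point (A l))"
      by (rule prod.union_disjoint) auto
    also have "(\<Prod>l\<in>{i, j, i', j'}. measure uniform_point (A l)) = (\<Prod>l\<in>{i, j, i', j'}. 1 / (25 * (real k)\<^sup>2))"
      by (intro prod.cong refl) (auto simp: A_def measure_cells(2)[OF k0 c(1)] measure_cells(2)[OF k0 c(2)])
    also have "\<dots> = (1 / (25 * (real k)\<^sup>2)) ^ 4"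
    proof -
      have "card {i, j, i', j'} = 4" using disj ij by auto
      then show ?thesis by (simp only: prod_constant)
    qed
    also have "(\<Prod>l\<in>{1..n} - {i, j, i', j'}. measure uniform_point (A l)) =
        (\<Prod>l\<in>{1..n} - {i, j, i', j'}. 1 - 2 / (real k)\<^sup>2)"
      by (intro prod.cong refl) (simp add: A_def compl[simplified])
    also have "\<dots> = (1 - 2 / (real k)\<^sup>2) ^ (n - 4)"
    proof -
      have "card {i, j, i', j'} = 4" "{i, j, i', j'} \<subseteq> {1..n}" using disj ij by auto
      then show ?thesis by (simp only: prod_constant) (simp add: card_Diff_subset)
    qed
    also have "\<dots> \<le> ((1 - 1 / (real k)\<^sup>2)\<^sup>2) ^ (n - 4)"
      using p1 by (intro power_mono) (auto simp: power2_eq_square algebra_simps)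
    also have "\<dots> = (1 - 1 / (real k)\<^sup>2) ^ (2 * (n - 4))" by (simp add: power_mult)
    finally show ?thesis by (simp add: mult_left_mono)
  qed (use w0 in simp)
qed

lemma isolated_lonely_pair:
  assumes k: "0 < k" and J: "(c, i, j) \<in> pair_indices n k" and x: "x \<in> lonely_pair n k (c, i, j)"
  shows "isolated_pair n x (3 / (10 * real k)) (4 / (10 * real k)) {i, j}"
proof -
  have ij: "i \<in> {1..n}" "j \<in> {1..n}" "i \<noteq> j" using J by (auto simp: pair_indices_def)
  have core: "x l \<in> cell_core k c" if "l \<in> {i, j}" for l
    using PiE_mem[OF x[unfolded lonely_pair_def prod.case], of l] ij that by (auto split: if_splits)
  have out: "x l \<notin> grid_cell k c" if "l \<in> {1..n} - {i, j}" for l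
    using PiE_mem[OF x[unfolded lonely_pair_def prod.case], of l] that by (auto split: if_splits)
  show ?thesis
    unfolding isolated_pair_def edge_length_doubleton
  proof (intro conjI ballI)
    show "{i, j} \<in> complete_edges n" using ij by (simp add: complete_edges_def)
    show "dist (x i) (x j) \<le> 3 / (10 * real k)" using core by (intro dist_cell_core_le[OF k]) auto
    fix u w assume "u \<in> {i, j}" "w \<in> {1..n} - {i, j}"
    then show "4 / (10 * real k) \<le> dist (x u) (x w)" by (intro dist_cell_core_ge[OF k, of _ c] core out)
  qed
qed

text \<open>The position of \<open>x i\<close> determines the cell, so different triples that hold
  at \<open>x\<close> give different edges.\<close>

lemma isolated_pairs_of_lonely_pairs:
  assumes k: "0 < k"
  obtains E where "finite E" "card E = card {J \<in> pair_indices n k. x \<in> lonely_pair n k J}"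
    "\<And>e. e \<in> E \<Longrightarrow> isolated_pair n x (3 / (10 * real k)) (4 / (10 * real k)) e"
proof -
  define Js where "Js = {J \<in> pair_indices n k. x \<in> lonely_pair n k J}"
  define pr where "pr = (\<lambda>(c :: nat \<times> nat, i :: nat, j :: nat). {i, j})"
  have "inj_on pr Js"
  proof (rule inj_onI)
    fix J J' assume JJ: "J \<in> Js" "J' \<in> Js" "pr J = pr J'"
    obtain c i j c' i' j' where eq: "J = (c, i, j)" "J' = (c', i', j')" by (metis prod.exhaust)
    have ij: "i \<in> {1..n}" "j < i" "j' < i'" using JJ by (auto simp: Js_def pair_indices_def eq)
    have "{i, j} = {i', j'}" using JJ(3) by (simp add: pr_def eq)
    then have ii: "i = i'" "j = j'" using ij by (auto simp: doubleton_eq_iff)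
    have x: "x \<in> lonely_pair n k (c, i, j)" "x \<in> lonely_pair n k (c', i, j)"
      using JJ unfolding Js_def eq ii by blast+
    have "x i \<in> cell_core k c" "x i \<in> cell_core k c'"
      using PiE_mem[OF x(1)[unfolded lonely_pair_def prod.case] ij(1)]
        PiE_mem[OF x(2)[unfolded lonely_pair_def prod.case] ij(1)] by simp_all
    then have "c = c'" using grid_cell_disjoint[OF k] cell_core_subset[OF k] by blast
    then show "J = J'" by (simp add: eq ii)
  qed
  then have "card (pr ` Js) = card Js" by (rule card_image)
  moreover have "finite (pr ` Js)" using finite_pair_indices by (simp add: Js_def)
  moreover have "isolated_pair n x (3 / (10 * real k)) (4 / (10 * real k)) e" if e: "e \<in> pr ` Js" for e
  proof -
    obtain c i j where "(c, i, j) \<in> Js" "e = {i, j}" using e unfolding pr_def by auto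
    then show ?thesis using isolated_lonely_pair[OF k] unfolding Js_def by blast
  qed
  ultimately show ?thesis using that unfolding Js_def by blast
qed

text \<open>The cell area is of order \<open>1 / n\<close>: cells are large enough for linearly many
  of them to hold a pair in the core, and small enough for the remaining points to avoid a given
  cell with probability at least \<open>1 / 2\<close>. The threshold is half of the lower bound for
  the mean.\<close>

lemma prob_few_lonely_pairs:
  assumes n: "4 \<le> n" and k: "2 * real n \<le> (real k)\<^sup>2" "(real k)\<^sup>2 \<le> 8 * real n"
  shows "measure (position_space n) {x \<in> space (position_space n).
      real (card {J \<in> pair_indices n k. x \<in> lonely_pair n k J}) \<le> (real n - 1) / 40000}
    \<le> 100000 / (real n - 1)"
proof -
  interpret P: prob_space "position_space n" by (rule prob_space_position_space)
  let ?I = "pair_indices n k"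
  define p where "p = 1 / (real k)\<^sup>2"
  define q where "q = 1 / (25 * (real k)\<^sup>2)"
  define \<mu> where "\<mu> = real (card ?I) * (q\<^sup>2 * (1 - p) ^ (n - 2))"
  have n0: "4 \<le> real n" using n by simp
  have k2: "2 \<le> k"
  proof (rule ccontr)
    assume "\<not> 2 \<le> k"
    then have "real k \<le> 1" by simp
    then have "(real k)\<^sup>2 \<le> 1\<^sup>2" by (intro power_mono) auto
    then show False using k n0 by simp
  qed
  then have k0: "0 < k" "0 < (real k)\<^sup>2" by auto
  have p: "0 \<le> p" "p \<le> 1 / (2 * real n)" "p \<le> 1 / 8"
  proof -
    show "p \<le> 1 / (2 * real n)" unfolding p_def using k n0 k0 by (intro divide_left_mono mult_pos_pos) auto
    also have "\<dots> \<le> 1 / 8" using n0 by (intro divide_left_mono) auto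
    finally show "p \<le> 1 / 8" .
  qed (simp add: p_def)
  have PJ: "lonely_pair n k J \<in> P.events" "P.prob (lonely_pair n k J) = q\<^sup>2 * (1 - p) ^ (n - 2)"
    if "J \<in> ?I" for J
    using that prob_lonely_pair[OF k0(1), of "fst J" "fst (snd J)" "snd (snd J)" n]
    by (simp_all add: p_def q_def)
  have PJJ: "P.prob (lonely_pair n k J \<inter> lonely_pair n k J') \<le> q ^ 4 * (1 - p) ^ (2 * (n - 4))"
    if "J \<in> ?I" "J' \<in> ?I - {J}" for J J'
  proof -
    have "J' \<in> ?I" "J \<noteq> J'" using that by blast+
    then show ?thesis unfolding p_def q_def by (rule prob_two_lonely_pairs[OF k2 n that(1)])
  qed
  have half: "1 / 2 \<le> (1 - p) ^ (n - 2)"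
  proof -
    have "real (n - 2) * p \<le> real n * (1 / (2 * real n))" using p by (intro mult_mono) auto
    also have "\<dots> = 1 / 2" using n0 by simp
    finally have "1 / 2 \<le> 1 + real (n - 2) * (- p)" by simp
    also have "\<dots> \<le> (1 + - p) ^ (n - 2)" using p by (intro Bernoulli_inequality) auto
    finally show ?thesis by simp
  qed
  have \<mu>_ge: "(real n - 1) / 20000 \<le> \<mu>"
  proof -
    \<comment> \<open>The number of triples contributes \<open>k\<^sup>2 * n * (n - 1) / 2\<close>,
      two points in a core \<open>1 / (625 * k ^ 4)\<close>; the rest is
      \<open>k\<^sup>2 \<le> 8 * n\<close> and \<open>half\<close>.\<close>
    have "(real n - 1) / 20000 = real n * (real n - 1) / 2 * (1 / (625 * (8 * real n))) * (1 / 2)"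
      using n0 by simp
    also have "\<dots> \<le> real n * (real n - 1) / 2 * (1 / (625 * (real k)\<^sup>2)) * (1 - p) ^ (n - 2)"
      using half n0 k k0 by (intro mult_mono mult_left_mono divide_left_mono) auto
    also have "\<dots> = \<mu>"
      using k0 unfolding \<mu>_def card_pair_indices q_def by (simp add: power2_eq_square)
    finally show ?thesis .
  qed
  then have \<mu>0: "0 < \<mu>" using n0 by simp
  have "P.prob {x\<in>space (position_space n). real (card {J\<in>?I. x \<in> lonely_pair n k J}) \<le> \<mu> - \<mu> / 2}
      \<le> (\<mu> + 8 * p * \<mu>\<^sup>2) / (\<mu> / 2)\<^sup>2"
  proof (rule P.count_lower_tail)
    show "\<mu> = (\<Sum>J\<in>?I. P.prob (lonely_pair n k J))" using PJ by (simp add: \<mu>_def)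
    have "(\<Sum>J\<in>?I. \<Sum>J'\<in>?I - {J}. P.prob (lonely_pair n k J \<inter> lonely_pair n k J'))
        \<le> (\<Sum>J\<in>?I. \<Sum>J'\<in>?I - {J}. q ^ 4 * (1 - p) ^ (2 * (n - 4)))"
      by (intro sum_mono PJJ)
    also have "\<dots> \<le> (\<Sum>J\<in>?I. \<Sum>J'\<in>?I. q ^ 4 * (1 - p) ^ (2 * (n - 4)))"
      using p finite_pair_indices by (intro sum_mono sum_mono2) auto
    also have "\<dots> = (real (card ?I))\<^sup>2 * (q ^ 4 * (1 - p) ^ (2 * (n - 4))) * 1" by (simp add: power2_eq_square)
    \<comment> \<open>The joint bound has exponent \<open>2 * (n - 4)\<close>, the squared mean
      \<open>2 * (n - 2)\<close>. The four missing factors \<open>1 - p\<close> are paid for by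
      \<open>1 + 8 * p\<close>.\<close>
    also have "\<dots> \<le> (real (card ?I))\<^sup>2 * (q ^ 4 * (1 - p) ^ (2 * (n - 4))) * ((1 + 8 * p) * (1 - p) ^ 4)"
    proof (intro mult_left_mono)
      have "1 \<le> (1 + 8 * p) * (1 - 4 * p)"
      proof -
        have "0 \<le> 4 * p * (1 - 8 * p)" using p by (intro mult_nonneg_nonneg) auto
        then show ?thesis by (simp add: algebra_simps)
      qed
      also have "\<dots> \<le> (1 + 8 * p) * (1 - p) ^ 4"
        using Bernoulli_inequality[of "- p" 4] p by (intro mult_left_mono) auto
      finally show "1 \<le> (1 + 8 * p) * (1 - p) ^ 4" .
    qed (use p in auto)
    also have "\<dots> = (1 + 8 * p) * \<mu>\<^sup>2"
    proof -
      have "2 * (n - 4) + 4 = (n - 2) * 2" using n by simp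
      then have "(1 - p) ^ (2 * (n - 4)) * (1 - p) ^ 4 = ((1 - p) ^ (n - 2))\<^sup>2"
        by (simp only: power_add[symmetric] power_mult[symmetric])
      moreover have "(real (card ?I))\<^sup>2 * (q ^ 4 * a) * ((1 + 8 * p) * b) =
        (1 + 8 * p) * ((real (card ?I))\<^sup>2 * ((q\<^sup>2)\<^sup>2 * (a * b)))" for a b
        by (simp add: mult_ac flip: power_mult)
      ultimately show ?thesis by (simp only: \<mu>_def power_mult_distrib)
    qed
    finally show "(\<Sum>J\<in>?I. \<Sum>J'\<in>?I - {J}. P.prob (lonely_pair n k J \<inter> lonely_pair n k J'))
        \<le> (1 + 8 * p) * \<mu>\<^sup>2" .
  qed (use PJ \<mu>0 finite_pair_indices in auto)
  also have "\<dots> = 4 / \<mu> + 32 * p" using \<mu>0 by (simp add: field_simps power2_eq_square)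
  also have "\<dots> \<le> 4 / ((real n - 1) / 20000) + 32 * (1 / (2 * real n))"
    using \<mu>_ge n0 p by (intro add_mono divide_left_mono mult_left_mono) auto
  also have "\<dots> \<le> 80000 / (real n - 1) + 16 / (real n - 1)"
    using n0 by (intro add_mono) (auto intro!: divide_left_mono)
  also have "\<dots> \<le> 100000 / (real n - 1)"
    using n0 by (simp add: add_divide_distrib[symmetric] divide_right_mono)
  finally have tail: "P.prob {x\<in>space (position_space n).
      real (card {J\<in>?I. x \<in> lonely_pair n k J}) \<le> \<mu> - \<mu> / 2} \<le> 100000 / (real n - 1)" .
  have "P.prob {x\<in>space (position_space n). real (card {J\<in>?I. x \<in> lonely_pair n k J}) \<le> (real n - 1) / 40000}
      \<le> P.prob {x\<in>space (position_space n). real (card {J\<in>?I. x \<in> lonely_pair n k J}) \<le> \<mu> - \<mu> / 2}"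
  proof (rule P.finite_measure_mono)
    show "{x\<in>space (position_space n). real (card {J\<in>?I. x \<in> lonely_pair n k J}) \<le> \<mu> - \<mu> / 2} \<in> P.events"
      using PJ(1) finite_pair_indices by (intro P.sets_card_le) auto
  qed (use \<mu>_ge in auto)
  then show ?thesis using tail by linarith
qed

section \<open>Random instances\<close>

lemma random_instance_eq:
  "random_instance n = position_space n \<Otimes>\<^sub>M color_space (complete_edges n) (n - 1)"
  by (simp add: random_instance_def position_space_def color_space_def uniform_point_def)

lemma complete_edges_endpoints:
  assumes "e \<in> complete_edges n"
  shows "Min e \<in> {1..n}" "Max e \<in> {1..n}"
proof -
  have "e \<subseteq> {1..n}" "card e = 2" using assms by (auto simp: complete_edges_def)
  moreover from this have "finite e" "e \<noteq> {}" by (auto simp: finite_subset)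
  ultimately show "Min e \<in> {1..n}" "Max e \<in> {1..n}" using Min_in Max_in by blast+
qed

section \<open>Measurability of the event\<close>

lemma total_length_measurable:
  assumes "T \<subseteq> complete_edges n"
  shows "(\<lambda>x. total_length x T) \<in> borel_measurable (position_space n)"
  unfolding total_length_def
proof (rule borel_measurable_sum)
  fix e assume "e \<in> T"
  then have e: "Min e \<in> {1..n}" "Max e \<in> {1..n}"
    using assms complete_edges_endpoints by blast+
  have comp: "(\<lambda>x. x i) \<in> borel_measurable (position_space n)" if "i \<in> {1..n}" for i
    using measurable_component_singleton[OF that, of "\<lambda>_. uniform_point"]
    by (simp add: position_space_def measurable_cong_sets[OF refl sets_uniform_point])
  show "(\<lambda>x. edge_length x e) \<in> borel_measurable (position_space n)"
    unfolding edge_length_def using comp[OF e(1)] comp[OF e(2)] by (rule borel_measurable_dist)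
qed

lemma Z_MST_opt_measurable: "(\<lambda>x. Z_MST_opt n x) \<in> borel_measurable (position_space n)"
  unfolding Z_MST_opt_def
proof (rule borel_measurable_Min)
  show "finite {T. spanning_tree n T}" using finite_spanning_trees[of n "\<lambda>_. True"] by simp
qed (simp add: spanning_tree_def total_length_measurable)

lemma Z_MST_measurable: "(\<lambda>x. Z_MST n x c) \<in> borel_measurable (position_space n)"
  unfolding Z_MST_def
  by (rule borel_measurable_Min[OF finite_spanning_trees]) (simp add: spanning_tree_def total_length_measurable)

definition good_instance :: "real \<Rightarrow> real \<Rightarrow> real \<Rightarrow> real \<Rightarrow> nat \<Rightarrow> (nat \<Rightarrow> point) \<Rightarrow> (edge \<Rightarrow> nat) \<Rightarrow> bool" where
  "good_instance a A b B n x col \<longleftrightarrow>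
      (\<exists>T. spanning_tree n T \<and> rainbow col T) \<and>
      a * sqrt (real n) \<le> Z_MST n x col \<and> Z_MST n x col \<le> A * sqrt (real n) \<and>
      b * sqrt (real n) \<le> Z_MST n x col - Z_MST_opt n x \<and>
      Z_MST n x col - Z_MST_opt n x \<le> B * sqrt (real n)"

lemma good_instance_measurable:
  "{x \<in> space (position_space n). good_instance a A b B n x c} \<in> sets (position_space n)"
proof (cases "\<exists>T. spanning_tree n T \<and> rainbow c T")
  case True
  note [measurable] = Z_MST_opt_measurable Z_MST_measurable
  show ?thesis unfolding good_instance_def using True by measurable
next
  case False
  then have "{x \<in> space (position_space n). good_instance a A b B n x c} = {}"
    by (auto simp: good_instance_def)
  then show ?thesis by (simp only: sets.empty_sets)
qed

text \<open>As there are finitely many colorings, the event is a finite union of measurable sets of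
  positions times single colorings.\<close>

lemma good_event_measurable:
  "{\<omega> \<in> space (random_instance n). case \<omega> of (x, c) \<Rightarrow> good_instance a A b B n x c} \<in> sets (random_instance n)"
proof -
  let ?C = "color_space (complete_edges n) (n - 1)"
  have fin: "finite (space ?C)" unfolding space_color_space by (intro finite_PiE) auto
  have "{\<omega> \<in> space (random_instance n). case \<omega> of (x, c) \<Rightarrow> good_instance a A b B n x c} =
     (\<Union>c\<in>space ?C. {x \<in> space (position_space n). good_instance a A b B n x c} \<times> {c})"
    by (auto simp: random_instance_eq space_pair_measure)
  moreover have "{c} \<in> sets ?C" if "c \<in> space ?C" for c
    using that by (intro sets_color_space) (auto simp: space_color_space)
  ultimately show ?thesis
    unfolding random_instance_eq
    using fin good_instance_measurable by (simp only:) (intro sets.finite_UN pair_measureI)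
qed

text \<open>Integrating the sections over \<open>X\<close> carries a bound that is uniform in the
  positions over to the product space. For \<open>\<epsilon> > 1\<close> the left side is not
  positive.\<close>

lemma prob_pair_ge:
  assumes "prob_space M1" "prob_space M2" and G: "G \<in> sets (M1 \<Otimes>\<^sub>M M2)" and X: "X \<in> sets M1"
    and sect: "\<And>x. x \<in> X \<Longrightarrow> 1 - \<epsilon> \<le> measure M2 (Pair x -` G)" and \<epsilon>: "0 \<le> \<epsilon>"
  shows "measure M1 X - \<epsilon> \<le> measure (M1 \<Otimes>\<^sub>M M2) G"
proof (cases "\<epsilon> \<le> 1")
  case True
  interpret M1: prob_space M1 by fact
  interpret M2: prob_space M2 by fact
  interpret P: pair_prob_space M1 M2 ..
  have "ennreal ((1 - \<epsilon>) * measure M1 X) = ennreal (1 - \<epsilon>) * emeasure M1 X"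
    using True by (simp add: M1.emeasure_eq_measure ennreal_mult)
  also have "\<dots> = (\<integral>\<^sup>+x. ennreal (1 - \<epsilon>) * indicator X x \<partial>M1)"
    using X by (simp add: nn_integral_cmult_indicator)
  also have "\<dots> \<le> (\<integral>\<^sup>+x. emeasure M2 (Pair x -` G) \<partial>M1)"
    by (intro nn_integral_mono) (auto simp: M2.emeasure_eq_measure indicator_def intro!: ennreal_leI sect)
  also have "\<dots> = emeasure (M1 \<Otimes>\<^sub>M M2) G"
    using G by (rule M2.emeasure_pair_measure_alt[symmetric])
  also have "\<dots> = ennreal (measure (M1 \<Otimes>\<^sub>M M2) G)" by (rule P.emeasure_eq_measure)
  finally have "(1 - \<epsilon>) * measure M1 X \<le> measure (M1 \<Otimes>\<^sub>M M2) G" by simp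
  moreover have "\<epsilon> * measure M1 X \<le> \<epsilon> * 1" using \<epsilon> M1.prob_le_1 by (intro mult_left_mono) auto
  ultimately show ?thesis by (simp add: algebra_simps)
next
  case False
  interpret M1: prob_space M1 by fact
  show ?thesis using False M1.prob_le_1[of X] measure_nonneg[of "M1 \<Otimes>\<^sub>M M2" G] by linarith
qed

lemma grid_size_exists:
  assumes "1 \<le> n"
  obtains k :: nat where "0 < k" "2 * real n \<le> (real k)\<^sup>2" "(real k)\<^sup>2 \<le> 8 * real n"
proof -
  \<comment> \<open>Rounding up gives \<open>2 * n \<le> k\<^sup>2\<close>; as the root is at least
    1, it at most doubles it, whence the factor 4 between the two bounds.\<close>
  define k where "k = nat \<lceil>sqrt (2 * real n)\<rceil>"
  have s: "1 \<le> sqrt (2 * real n)" using assms by simp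
  have k: "sqrt (2 * real n) \<le> real k" "real k \<le> sqrt (2 * real n) + 1"
    unfolding k_def using s by linarith+
  have "(sqrt (2 * real n))\<^sup>2 \<le> (real k)\<^sup>2" using k s by (intro power_mono) auto
  moreover have "real k \<le> 2 * sqrt (2 * real n)" using k s by linarith
  then have "(real k)\<^sup>2 \<le> (2 * sqrt (2 * real n))\<^sup>2" by (intro power_mono) auto
  moreover have "0 < k" using k s by (cases k) auto
  ultimately show ?thesis using that by (simp add: power_mult_distrib)
qed

text \<open>More than \<open>m * (m - 1) / (8 * N)\<close> repetitions, a linear number, allow as
  many exchanges, each saving \<open>1 / (10 * k)\<close> with \<open>k \<le> 3 * sqrt n\<close>.
  Together this is at least \<open>sqrt n / (48 * 10 ^ 11)\<close>, which \<open>1 / 10 ^ 13\<close>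
  rounds down.\<close>

lemma good_instance_of_bounds:
  fixes N :: nat
  assumes N: "80000 \<le> N" and k: "0 < k" "(real k)\<^sup>2 \<le> 8 * real (N + 1)"
    and T: "spanning_tree (N + 1) T" "rainbow c T" "total_length x T \<le> 8 * sqrt 120 * sqrt (real N)"
    and E: "finite E" "\<And>e. e \<in> E \<Longrightarrow> isolated_pair (N + 1) x (3 / (10 * real k)) (4 / (10 * real k)) e"
    and m: "card E = m" "real N / 40000 \<le> real m"
    and rep: "real m * (real m - 1) / (8 * real N) < real m - real (card (c ` E))"
  shows "good_instance (1 / 10 ^ 13) (8 * sqrt 120) (1 / 10 ^ 13) (8 * sqrt 120) (N + 1) x c"
proof -
  define n where "n = N + 1"
  have N0: "80000 \<le> real N" and n0: "0 < real n" and nN: "real n \<le> 2 * real N"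
    using N by (auto simp: n_def)
  have k0: "0 < real k" using k by simp
  have opt: "0 \<le> Z_MST_opt n x" using Z_MST_opt_nonneg[OF T(1)] by (simp add: n_def)
  have "Z_MST n x c \<le> 8 * sqrt 120 * sqrt (real N)"
    using Z_MST_le[OF T(1,2), of x] T(3) by (simp add: n_def)
  also have "\<dots> \<le> 8 * sqrt 120 * sqrt (real n)" by (intro mult_left_mono) (auto simp: n_def)
  finally have upper: "Z_MST n x c \<le> 8 * sqrt 120 * sqrt (real n)" .
  have "real n / (16 * 10 ^ 10) \<le> real m * (real m - 1) / (8 * real N)"
  proof -
    have m2: "2 \<le> real m" using m(2) N0 by linarith
    have "real N / 40000 * (real N / 40000 / 2) \<le> real m * (real m - 1)"
      using m(2) m2 N0 by (intro mult_mono) auto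
    then have "real N / 40000 * (real N / 40000 / 2) / (8 * real N) \<le> real m * (real m - 1) / (8 * real N)"
      using N0 by (intro divide_right_mono) auto
    moreover have "real N / 40000 * (real N / 40000 / 2) / (8 * real N) = real N / 25600000000"
      using N0 by (simp add: field_simps)
    ultimately show ?thesis using nN by simp
  qed
  also have "\<dots> \<le> real m - real (card (c ` E))" using rep by simp
  finally have "real n / (16 * 10 ^ 10) * (4 / (10 * real k) - 3 / (10 * real k)) \<le>
     (real (card E) - real (card (c ` E))) * (4 / (10 * real k) - 3 / (10 * real k))"
    unfolding m(1) using k0 by (intro mult_right_mono) (auto simp: field_simps)
  also have "\<dots> \<le> Z_MST n x c - Z_MST_opt n x"
    unfolding n_def using k0 E by (intro Z_MST_gap[OF T(1,2)]) (auto simp: field_simps)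
  finally have gap: "real n / (16 * 10 ^ 10) * (1 / (10 * real k)) \<le> Z_MST n x c - Z_MST_opt n x"
    by (simp add: diff_divide_distrib[symmetric])
  have "real k \<le> sqrt (8 * real n)" using k by (intro real_le_rsqrt) (simp add: n_def)
  also have "\<dots> \<le> sqrt (9 * real n)" using n0 by (intro real_sqrt_le_mono) auto
  also have "\<dots> = 3 * sqrt (real n)" by (simp add: real_sqrt_mult)
  finally have k_le: "real k \<le> 3 * sqrt (real n)" .
  have "1 / 10 ^ 13 * sqrt (real n) \<le> real n / (16 * 10 ^ 10) * (1 / (10 * (3 * sqrt (real n))))"
  proof -
    have "real n / (16 * 10 ^ 10) * (1 / (10 * (3 * s))) = real n / s / (48 * 10 ^ 11)" for s
      by simp
    then have "real n / (16 * 10 ^ 10) * (1 / (10 * (3 * sqrt (real n)))) = sqrt (real n) / (48 * 10 ^ 11)"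
      using n0 by (simp only: real_div_sqrt less_imp_le)
    moreover have "1 / 10 ^ 13 * s \<le> s / (48 * 10 ^ 11)" if "0 \<le> s" for s :: real
      using that by simp
    ultimately show ?thesis by (simp only: real_sqrt_ge_zero of_nat_0_le_iff)
  qed
  also have "\<dots> \<le> real n / (16 * 10 ^ 10) * (1 / (10 * real k))"
    using k_le k0 n0 by (intro mult_left_mono divide_left_mono) auto
  also note gap
  finally have "1 / 10 ^ 13 * sqrt (real n) \<le> Z_MST n x c - Z_MST_opt n x" .
  then show ?thesis using upper opt T(1,2) unfolding good_instance_def n_def by auto
qed

text \<open>For fixed good positions two color events can fail: a short rainbow tree, and enough
  repetitions on the isolated pairs. They need not be independent; their failure probabilities are
  added.\<close>

lemma prob_good_section:
  assumes N: "80000 \<le> N" and k: "0 < k" "(real k)\<^sup>2 \<le> 8 * real (N + 1)"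
    and x: "\<And>i. i \<in> {1..N + 1} \<Longrightarrow> x i \<in> unit_square"
      "real N / 40000 < real (card {J \<in> pair_indices (N + 1) k. x \<in> lonely_pair (N + 1) k J})"
    and C: "(\<Sum>s=1..N. hall_term N s) \<le> C / real N"
  shows "1 - (C + 256 * 40000 ^ 4) / real N \<le>
    measure (color_space (complete_edges (N + 1)) N) {c \<in> space (color_space (complete_edges (N + 1)) N).
      good_instance (1 / 10 ^ 13) (8 * sqrt 120) (1 / 10 ^ 13) (8 * sqrt 120) (N + 1) x c}"
proof -
  let ?E = "complete_edges (N + 1)"
  let ?M = "color_space ?E N"
  have N0: "80000 \<le> real N" using N by simp
  interpret prob_space ?M using N by (intro prob_space_color_space) simp
  have ev: "A \<in> events" if "A \<subseteq> space ?M" for A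
    using that sets_color_space[OF finite_complete_edges] by (simp only: space_color_space)
  obtain F where F: "finite F" "card F = card {J \<in> pair_indices (N + 1) k. x \<in> lonely_pair (N + 1) k J}"
    "\<And>e. e \<in> F \<Longrightarrow> isolated_pair (N + 1) x (3 / (10 * real k)) (4 / (10 * real k)) e"
    using isolated_pairs_of_lonely_pairs[OF k(1)] by blast
  \<comment> \<open>The isolated pairs are cut down to a number determined by \<open>N\<close>, for
    which \<open>2 \<le> m\<close> and \<open>m \<le> N\<close> are immediate.\<close>
  define m where "m = nat \<lceil>real N / 40000\<rceil>"
  have m: "real N / 40000 \<le> real m" "real m < real N / 40000 + 1"
    unfolding m_def using N0 by linarith+
  have "m \<le> card F" using x(2) unfolding F(2) m_def by linarith
  then obtain E where E: "E \<subseteq> F" "card E = m" "finite E"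
    by (rule obtain_subset_with_card_n)
  have sub: "E \<subseteq> ?E" using E(1) F(3) unfolding isolated_pair_def by blast
  define B1 where "B1 = {c \<in> space ?M. \<not> (\<exists>T. spanning_tree (N + 1) T \<and> rainbow c T \<and>
    total_length x T \<le> 8 * sqrt 120 * sqrt (real N))}"
  define B2 where "B2 = {c \<in> space ?M.
      real m - real (card (c ` E)) \<le> real m * (real m - 1) / (8 * real N)}"
  define G where "G = {c \<in> space ?M.
      good_instance (1 / 10 ^ 13) (8 * sqrt 120) (1 / 10 ^ 13) (8 * sqrt 120) (N + 1) x c}"
  have B: "B1 \<in> events" "B2 \<in> events"
    unfolding B1_def B2_def by (rule ev; blast)+
  have "prob B1 \<le> (\<Sum>s=1..N. hall_term N s)"
    unfolding B1_def using N x(1) by (intro prob_no_short_rainbow_tree) auto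
  then have pB1: "prob B1 \<le> C / real N" using C by simp
  have "prob B2 \<le> 64 * real N ^ 3 / (real m * (real m - 1))\<^sup>2"
    unfolding B2_def
  proof (rule prob_few_repeated_colors[OF finite_complete_edges sub _ E(2)])
    have "2 \<le> real m" "real m \<le> real N" using m N0 by linarith+
    then show "2 \<le> m" "m \<le> N" by simp_all
  qed (use N in simp)
  also have "\<dots> \<le> 64 * real N ^ 3 / (real N / 40000 * (real N / 40000 / 2))\<^sup>2"
    using m N0 by (intro divide_left_mono power_mono mult_mono mult_pos_pos zero_less_power) auto
  also have "\<dots> = 256 * 40000 ^ 4 / real N"
    using N0 by (simp add: power2_eq_square power3_eq_cube)
  finally have pB2: "prob B2 \<le> 256 * 40000 ^ 4 / real N" .
  have "prob (B1 \<union> B2) \<le> prob B1 + prob B2" using B by (rule measure_Un_le)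
  also have "\<dots> \<le> (C + 256 * 40000 ^ 4) / real N" using pB1 pB2 by (simp add: add_divide_distrib)
  finally have "1 - (C + 256 * 40000 ^ 4) / real N \<le> prob (space ?M - (B1 \<union> B2))"
    using prob_compl[of "B1 \<union> B2"] B by simp
  also have "\<dots> \<le> prob G"
  proof (rule finite_measure_mono)
    show "space ?M - (B1 \<union> B2) \<subseteq> G"
    proof
      fix c assume c: "c \<in> space ?M - (B1 \<union> B2)"
      then obtain T where T: "spanning_tree (N + 1) T" "rainbow c T"
          "total_length x T \<le> 8 * sqrt 120 * sqrt (real N)"
        unfolding B1_def by blast
      have rep: "real m * (real m - 1) / (8 * real N) < real m - real (card (c ` E))"
        using c unfolding B2_def by (simp add: not_le)
      have iso: "\<And>e. e \<in> E \<Longrightarrow> isolated_pair (N + 1) x (3 / (10 * real k)) (4 / (10 * real k)) e"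
        using E(1) F(3) by blast
      have "good_instance (1 / 10 ^ 13) (8 * sqrt 120) (1 / 10 ^ 13) (8 * sqrt 120) (N + 1) x c"
        by (rule good_instance_of_bounds[OF N k T E(3) iso E(2) m(1) rep])
      then show "c \<in> G" using c unfolding G_def by blast
    qed
    show "G \<in> events" unfolding G_def by (rule ev) blast
  qed
  finally show ?thesis by (simp only: G_def)
qed

text \<open>Bad positions cost \<open>100000 / N\<close>; for all other positions the colors fail
  with probability at most \<open>(C + 256 * 40000 ^ 4) / N\<close>.\<close>

lemma prob_good_instance_ge:
  fixes C :: real
  assumes N: "80000 \<le> N" and C: "(\<Sum>s=1..N. hall_term N s) \<le> C / real N" "0 \<le> C"
  shows "1 - (C + 256 * 40000 ^ 4 + 100000) / real N \<le>
    measure (random_instance (N + 1)) {\<omega> \<in> space (random_instance (N + 1)). case \<omega> of (x, c) \<Rightarrow>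
      good_instance (1 / 10 ^ 13) (8 * sqrt 120) (1 / 10 ^ 13) (8 * sqrt 120) (N + 1) x c}"
proof -
  let ?n = "N + 1"
  let ?P = "position_space ?n"
  let ?M = "color_space (complete_edges ?n) N"
  interpret P: prob_space ?P by (rule prob_space_position_space)
  obtain k where k: "0 < k" "2 * real ?n \<le> (real k)\<^sup>2" "(real k)\<^sup>2 \<le> 8 * real ?n"
    using grid_size_exists[of ?n] by auto
  define A where "A = {x \<in> space ?P. real (card {J \<in> pair_indices ?n k. x \<in> lonely_pair ?n k J}) \<le> real N / 40000}"
  \<comment> \<open>The product space contains all points of the plane. Lying in the square, which
    the ranking relies on, is an event of probability 1.\<close>
  define S where "S = Pi\<^sub>E {1..?n} (\<lambda>_. unit_square)"
  define G where "G = {\<omega> \<in> space (random_instance ?n). case \<omega> of (x, c) \<Rightarrow>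
      good_instance (1 / 10 ^ 13) (8 * sqrt 120) (1 / 10 ^ 13) (8 * sqrt 120) ?n x c}"
  have A_ev: "A \<in> P.events"
    unfolding A_def
  proof (rule P.sets_card_le[OF finite_pair_indices])
    fix J assume "J \<in> pair_indices ?n k"
    then show "lonely_pair ?n k J \<in> P.events"
      using prob_lonely_pair(1)[OF k(1)] by (cases J) auto
  qed
  have sq: "unit_square \<in> sets borel" by (simp add: unit_square_cbox)
  have S: "S \<in> P.events" "P.prob S = 1"
    using box_position_space[of ?n "\<lambda>_. unit_square"] sq measure_uniform_point_square
    by (simp_all add: S_def)
  have "P.prob A \<le> 100000 / real N"
    using prob_few_lonely_pairs[OF _ k(2,3)] N by (simp add: A_def)
  moreover have "P.prob (S \<inter> A) \<le> P.prob A" using A_ev by (intro P.finite_measure_mono) auto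
  moreover have "P.prob (S - A) = P.prob S - P.prob (S \<inter> A)"
    using S(1) A_ev by (rule P.finite_measure_Diff')
  ultimately have 1: "1 - 100000 / real N \<le> P.prob (S - A)" using S(2) by linarith
  have "P.prob (S - A) - (C + 256 * 40000 ^ 4) / real N \<le> measure (?P \<Otimes>\<^sub>M ?M) G"
  proof (rule prob_pair_ge[OF P.prob_space_axioms])
    show "prob_space ?M" using N by (intro prob_space_color_space) simp
    show "G \<in> sets (?P \<Otimes>\<^sub>M ?M)"
      using good_event_measurable[where n = ?n] unfolding G_def random_instance_eq add_diff_cancel_right' .
    show "S - A \<in> P.events" using S A_ev by auto
    show "0 \<le> (C + 256 * 40000 ^ 4) / real N" using C by simp
  next
    fix x assume x: "x \<in> S - A"
    then have xS: "x \<in> space ?P" using sets.sets_into_space[OF S(1)] by blast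
    have "Pair x -` G = {c \<in> space ?M.
        good_instance (1 / 10 ^ 13) (8 * sqrt 120) (1 / 10 ^ 13) (8 * sqrt 120) ?n x c}"
      using xS unfolding G_def random_instance_eq add_diff_cancel_right' space_pair_measure by blast
    moreover have "1 - (C + 256 * 40000 ^ 4) / real N \<le> measure ?M {c \<in> space ?M.
        good_instance (1 / 10 ^ 13) (8 * sqrt 120) (1 / 10 ^ 13) (8 * sqrt 120) ?n x c}"
    proof (rule prob_good_section[OF N k(1,3) _ _ C(1)])
      fix i assume "i \<in> {1..?n}"
      then show "x i \<in> unit_square" using x unfolding S_def by (blast dest: PiE_mem)
    next
      show "real N / 40000 < real (card {J \<in> pair_indices ?n k. x \<in> lonely_pair ?n k J})"
      proof (rule ccontr)
        assume "\<not> ?thesis"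
        then have "x \<in> A" using xS unfolding A_def by (simp only: mem_Collect_eq not_less simp_thms)
        then show False using x by blast
      qed
    qed
    ultimately show "1 - (C + 256 * 40000 ^ 4) / real N \<le> measure ?M (Pair x -` G)" by (simp only:)
  qed
  then have "1 - (C + 256 * 40000 ^ 4 + 100000) / real N \<le> measure (?P \<Otimes>\<^sub>M ?M) G"
    using 1 by (simp add: add_divide_distrib)
  then show ?thesis unfolding G_def random_instance_eq add_diff_cancel_right' .
qed

theorem theorem1:
  shows "\<exists>a A b B :: real. 0 < a \<and> 0 < A \<and> 0 < b \<and> 0 < B \<and>
    whp random_instance (\<lambda>n (x, col).
      (\<exists>T. spanning_tree n T \<and> rainbow col T) \<and>
      a * sqrt (real n) \<le> Z_MST n x col \<and> Z_MST n x col \<le> A * sqrt (real n) \<and>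
      b * sqrt (real n) \<le> Z_MST n x col - Z_MST_opt n x \<and>
      Z_MST n x col - Z_MST_opt n x \<le> B * sqrt (real n))"
proof -
  let ?p = "\<lambda>n. measure (random_instance n) {\<omega> \<in> space (random_instance n). case \<omega> of (x, c) \<Rightarrow>
      good_instance (1 / 10 ^ 13) (8 * sqrt 120) (1 / 10 ^ 13) (8 * sqrt 120) n x c}"
  obtain C0 where C0: "\<And>N. 13000 \<le> N \<Longrightarrow> (\<Sum>s=1..N. hall_term N s) \<le> C0 / real N"
    using sum_hall_term_le by blast
  define C where "C = max C0 0"
  define K where "K = C + 256 * 40000 ^ 4 + 100000"
  have "?p \<longlonglongrightarrow> 1"
  \<comment> \<open>All estimates are in terms of the number \<open>N = n - 1\<close> of colors,
    hence the shift by one.\<close>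
  proof (rule LIMSEQ_offset[of _ 1], rule tendsto_sandwich)
    show "eventually (\<lambda>N. 1 - K * inverse (real N) \<le> ?p (N + 1)) sequentially"
    proof (rule eventually_sequentiallyI[of 80000])
      fix N :: nat assume N: "80000 \<le> N"
      have "C0 / real N \<le> C / real N" by (intro divide_right_mono) (auto simp: C_def)
      then have "(\<Sum>s=1..N. hall_term N s) \<le> C / real N" using C0[of N] N by linarith
      then show "1 - K * inverse (real N) \<le> ?p (N + 1)"
        using prob_good_instance_ge[OF N, of C] unfolding K_def divide_inverse[symmetric]
        by (simp only: C_def max.cobounded2)
    qed
    have prob: "prob_space (random_instance (N + 1))" if "0 < N" for N
    proof -
      interpret X: prob_space "position_space (N + 1)" by (rule prob_space_position_space)
      interpret C: prob_space "color_space (complete_edges (N + 1)) N" using that by (rule prob_space_color_space)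
      interpret XC: pair_prob_space "position_space (N + 1)" "color_space (complete_edges (N + 1)) N" ..
      show ?thesis unfolding random_instance_eq add_diff_cancel_right' by (rule XC.P.prob_space_axioms)
    qed
    show "eventually (\<lambda>N. ?p (N + 1) \<le> 1) sequentially"
      by (rule eventually_sequentiallyI[of 1]) (intro prob_space.prob_le_1 prob, simp)
    have "(\<lambda>N. 1 - K * inverse (real N)) \<longlonglongrightarrow> 1 - K * 0"
      by (intro tendsto_intros lim_inverse_n)
    then show "(\<lambda>N. 1 - K * inverse (real N)) \<longlonglongrightarrow> 1" by simp
  qed simp
  then have "whp random_instance (\<lambda>n (x, c).
      good_instance (1 / 10 ^ 13) (8 * sqrt 120) (1 / 10 ^ 13) (8 * sqrt 120) n x c)"
    by (simp only: whp_def)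
  then have "0 < (1 / 10 ^ 13 :: real) \<and> 0 < 8 * sqrt (120 :: real) \<and> 0 < (1 / 10 ^ 13 :: real) \<and>
      0 < 8 * sqrt (120 :: real) \<and> whp random_instance (\<lambda>n (x, c).
      good_instance (1 / 10 ^ 13) (8 * sqrt 120) (1 / 10 ^ 13) (8 * sqrt 120) n x c)"
    by (intro conjI) simp_all
  then show ?thesis
    unfolding good_instance_def
    by (rule exI[of _ "1 / 10 ^ 13", OF exI[of _ "8 * sqrt 120", OF exI[of _ "1 / 10 ^ 13", OF exI[of _ "8 * sqrt 120"]]]])
qed

end
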